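(* Let $(X,d)$ be a Cantor space. If $f\in\mathcal{H}(X)$ is topologically stable in the strong sense, then $f$ has the shadowing property and the non-wandering set $\Omega(f)$ is finite.
   Context: A Cantor space is a compact metric space without isolated points that is totally disconnected. $\mathcal{H}(X)$ is the set of homeomorphisms; $d_{C^0}(f,g)=\sup_x d(f(x),g(x))$; $D(f,g)=\max\{d_{C^0}(f,g),d_{C^0}(f^{-1},g^{-1})\}$. $f$ is topologically stable in the strong sense if for every $\epsilon>0$ there is $\delta>0$ such that for every $g\in\mathcal{H}(X)$ with $D(f,g)<\delta$ there is a surjective continuous $h:X\to X$ with $d_{C^0}(h,\mathrm{id}_X)<\epsilon$ and $h\circ g=f\circ h$. $f$ has the shadowing property if for every $\epsilon>0$ there is $\delta>0$ such that every sequence $(x_i)_{i\ge0}$ with $d(f(x_i),x_{i+1})\le\delta$ for all $i$ admits $x\in X$ with $d(x_i,f^i(x))\le\epsilon$ for all $i\ge0$. $\Omega(f)$ is the set of $x$ such that for every neighborhood $U$ of $x$ there is $n>0$ with $f^n(U)\cap U\neq\emptyset$. *)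

theory Defs
  imports "HOL-Analysis.Analysis"
begin

definition totally_disconnected_set :: "'a::topological_space set \<Rightarrow> bool" where
  "totally_disconnected_set X \<longleftrightarrow> (\<forall>C. C \<subseteq> X \<and> connected C \<longrightarrow> (\<exists>a. C \<subseteq> {a}))"

definition cantor_space :: "'a::metric_space set \<Rightarrow> bool" where
  "cantor_space X \<longleftrightarrow> compact X \<and> (\<forall>x\<in>X. x islimpt X) \<and> totally_disconnected_set X"

definition homeos :: "'a::topological_space set \<Rightarrow> ('a \<Rightarrow> 'a) set" where
  "homeos X = {f. \<exists>g. homeomorphism X X f g}"

definition dC0 :: "'a::metric_space set \<Rightarrow> ('a \<Rightarrow> 'a) \<Rightarrow> ('a \<Rightarrow> 'a) \<Rightarrow> real" where
  "dC0 X f g = (SUP x\<in>X. dist (f x) (g x))"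

definition Dhom :: "'a::metric_space set \<Rightarrow> ('a \<Rightarrow> 'a) \<Rightarrow> ('a \<Rightarrow> 'a) \<Rightarrow> real" where
  "Dhom X f g = max (dC0 X f g) (dC0 X (inv_into X f) (inv_into X g))"

definition strongly_topologically_stable :: "'a::metric_space set \<Rightarrow> ('a \<Rightarrow> 'a) \<Rightarrow> bool" where
  "strongly_topologically_stable X f \<longleftrightarrow>
     (\<forall>\<epsilon>>0. \<exists>\<delta>>0. \<forall>g\<in>homeos X. Dhom X f g < \<delta> \<longrightarrow>
        (\<exists>h. continuous_on X h \<and> h ` X = X \<and> dC0 X h id < \<epsilon> \<and>
             (\<forall>x\<in>X. h (g x) = f (h x))))"

definition shadowing :: "'a::metric_space set \<Rightarrow> ('a \<Rightarrow> 'a) \<Rightarrow> bool" where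
  "shadowing X f \<longleftrightarrow>
     (\<forall>\<epsilon>>0. \<exists>\<delta>>0. \<forall>xs::nat \<Rightarrow> 'a. (\<forall>i. xs i \<in> X) \<and> (\<forall>i. dist (f (xs i)) (xs (Suc i)) \<le> \<delta>) \<longrightarrow>
        (\<exists>x\<in>X. \<forall>i. dist (xs i) ((f ^^ i) x) \<le> \<epsilon>))"

definition nonwandering :: "'a::topological_space set \<Rightarrow> ('a \<Rightarrow> 'a) \<Rightarrow> 'a set" where
  "nonwandering X f = {x\<in>X. \<forall>U. openin (top_of_set X) U \<and> x \<in> U \<longrightarrow>
                          (\<exists>n>0. (f ^^ n) ` U \<inter> U \<noteq> {})}"

end

(* By total disconnectedness every homeomorphism that maps each point into the same cell of a fine clopen
   partition as f does is D-close to f, and by Brouwer's characterisation any two nonempty clopen sets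
   are homeomorphic, so cell-preserving rearrangements are available in abundance.

   Shadowing: a finite pseudo-orbit is moved slightly so that its points become distinct; then some nearby g
   has it as a genuine orbit, and the semiconjugacy h maps this orbit to an orbit of f that shadows it.
   Compactness passes to infinite pseudo-orbits.

   Finiteness: there is a nearby g with a finite invariant set F meeting every nonempty closed forward
   g-invariant set.  In each cell choose small disjoint clopen sets S (attracting) and N (repelling) and
   compose f with a north-south map sending the complement of N onto S.  Orbits of g either fall into the
   union of the sets S or stay forever in the preimage T of the sets N; both g on S and the inverse of g
   on T permute pieces up to inclusion, and one can make the return maps contract to a point.  The
   property passes to f through h.  If x were nonwandering for f and outside h(F), shadowing a
   periodic pseudo-orbit near x would give a closed invariant set missing h(F). *)
theory Submission
  imports Defs
begin

section \<open>Cantor spaces\<close>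

text \<open>The semiconjugacy \<open>h\<close> goes from the perturbation \<open>g\<close> to
  \<open>f\<close> and need not be injective, so whatever is arranged for \<open>g\<close> must
  survive passage to a factor. Finiteness of the non-wandering set is not of this kind: a
  non-wandering point of a factor need not be the image of a non-wandering point. Meeting every
  closed invariant set does survive, because preimages under \<open>h\<close> of closed invariant
  sets are closed and invariant. Shadowing then leads from this weaker property back to the
  non-wandering set, which is why the first conclusion is an ingredient of the second. Two points
  shape the construction of \<open>g\<close>. The correction that makes a return map contract needs
  the image of a piece to be a proper subset of the piece it enters; one extra point per cell is
  reserved to guarantee this. And two corrections are made, one for the attracting and one for the
  repelling pieces. The first is applied after the map and is supported in the attracting pieces,
  the second before the map and supported in preimages of the repelling pieces. These supports are
  disjoint, so the second does not destroy the effect of the first.\<close>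

definition clopenin :: "'a::topological_space set \<Rightarrow> 'a set \<Rightarrow> bool" where
  "clopenin X U \<longleftrightarrow> openin (top_of_set X) U \<and> closedin (top_of_set X) U"

lemma clopenin_subset: "clopenin X U \<Longrightarrow> U \<subseteq> X"
  by (auto simp: clopenin_def dest: openin_imp_subset)

lemma clopenin_self [simp]: "clopenin X X"
  by (simp add: clopenin_def)

lemma clopenin_Int: "clopenin X U \<Longrightarrow> clopenin X V \<Longrightarrow> clopenin X (U \<inter> V)"
  by (auto simp: clopenin_def)

lemma clopenin_Un: "clopenin X U \<Longrightarrow> clopenin X V \<Longrightarrow> clopenin X (U \<union> V)"
  by (auto simp: clopenin_def)

lemma clopenin_Diff: "clopenin X U \<Longrightarrow> clopenin X V \<Longrightarrow> clopenin X (U - V)"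
  by (auto simp: clopenin_def openin_diff closedin_diff)

lemma clopenin_UN:
  assumes "finite I" "\<And>i. i \<in> I \<Longrightarrow> clopenin X (U i)"
  shows "clopenin X (\<Union>i\<in>I. U i)"
  using assms unfolding clopenin_def by (auto intro!: openin_Union closedin_Union)

lemma clopenin_INT:
  assumes "finite I" "I \<noteq> {}" "\<And>i. i \<in> I \<Longrightarrow> clopenin X (U i)"
  shows "clopenin X (\<Inter>i\<in>I. U i)"
  using assms unfolding clopenin_def by (auto intro!: openin_Inter closedin_Inter)

lemma clopenin_relative: "clopenin X V \<Longrightarrow> V \<subseteq> U \<Longrightarrow> U \<subseteq> X \<Longrightarrow> clopenin U V"
  unfolding clopenin_def by (meson closedin_subset_trans openin_subset_trans)

lemma clopenin_compact: "compact X \<Longrightarrow> clopenin X U \<Longrightarrow> compact U"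
  by (auto simp: clopenin_def closedin_compact)

lemma clopenin_vimage:
  assumes "continuous_on X f" "f ` X \<subseteq> Y" "clopenin Y U"
  shows "clopenin X {x\<in>X. f x \<in> U}"
proof -
  have "{x\<in>X. f x \<in> U} = X \<inter> f -` U" by auto
  with assms show ?thesis
    unfolding clopenin_def
    using continuous_closedin_preimage_gen[of X f Y U] continuous_openin_preimage[of X f Y U] by auto
qed

section \<open>Clopen neighbourhoods, fine covers and separating families\<close>

lemma cantor_space_compact: "cantor_space X \<Longrightarrow> compact X"
  by (simp add: cantor_space_def)

lemma cantor_space_clopenin:
  assumes X: "cantor_space X" and U: "clopenin X U"
  shows "cantor_space U"
  unfolding cantor_space_def
proof (intro conjI ballI)
  show "compact U"
    using X U clopenin_compact cantor_space_compact by blast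
  show "totally_disconnected_set U"
    using X clopenin_subset[OF U] unfolding cantor_space_def totally_disconnected_set_def by blast
next
  fix x assume x: "x \<in> U"
  obtain T where T: "open T" "U = X \<inter> T"
    using U by (auto simp: clopenin_def openin_open)
  have "x islimpt X"
    using X x T by (auto simp: cantor_space_def)
  then show "x islimpt U"
    using T x unfolding islimpt_def by (metis Int_iff open_Int)
qed

text \<open>Absence of isolated points in the form used later: finitely many forbidden points never
  exhaust a nonempty open set.\<close>

lemma cantor_space_openin_infinite:
  assumes "cantor_space X" "openin (top_of_set X) W" "W \<noteq> {}"
  shows "infinite W"
proof -
  obtain x where x: "x \<in> W" using assms by blast
  then have "x islimpt X"
    using assms openin_imp_subset unfolding cantor_space_def by blast
  then show ?thesis using infinite_openin[OF assms(2) x] by blast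
qed

text \<open>Total disconnectedness only says that components are points. The passage to clopen sets
  uses compactness, through Wilder's theorem: a compact component inside an open set of a locally
  compact Hausdorff space is cut off by a separation within that set.\<close>

lemma clopenin_neighbourhood:
  assumes X: "cantor_space X" and W: "openin (top_of_set X) W" and x: "x \<in> W"
  obtains U where "clopenin X U" "x \<in> U" "U \<subseteq> W"
proof -
  let ?T = "top_of_set X"
  have cX: "compact X" and xX: "x \<in> X"
    using X W x openin_imp_subset by (auto simp: cantor_space_def)
  have "connectedin ?T (connected_component_of_set ?T x)"
    by (simp add: connectedin_connected_component_of)
  then have "connected (connected_component_of_set ?T x)" "connected_component_of_set ?T x \<subseteq> X"
    by (auto simp: connectedin_subtopology)
  moreover have "x \<in> connected_component_of_set ?T x"
    using xX by (simp add: connected_component_of_refl)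
  ultimately have "connected_component_of_set ?T x = {x}"
    using X unfolding cantor_space_def totally_disconnected_set_def by (metis singletonD subset_singleton_iff empty_iff)
  then have "{x} \<in> connected_components_of ?T"
    by (metis connected_component_in_connected_components_of topspace_euclidean_subtopology xX)
  moreover have "locally_compact_space ?T" "Hausdorff_space ?T"
    using cX by (auto intro!: compact_imp_locally_compact_space Hausdorff_space_subtopology
        simp: compact_space_subtopology)
  ultimately obtain U V where UV: "openin ?T U" "openin ?T V" "disjnt U V" "U \<union> V = X" "{x} \<subseteq> U" "U \<subseteq> W"
    using wilder_locally_compact_component_thm[of ?T "{x}" W] W x xX
    by (auto simp: compactin_subtopology)
  then have "U = X - V" by (auto simp: disjnt_def)
  then have "clopenin X U"
    using UV unfolding clopenin_def by (metis closedin_diff closedin_subtopology_refl subset_UNIV closedin_topspace topspace_euclidean_subtopology)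
  then show ?thesis using UV that by auto
qed

lemma fine_clopen_cover:
  assumes X: "cantor_space X" and e: "e > 0"
  obtains \<F> where "finite \<F>" "\<Union>\<F> = X" "\<And>W. W \<in> \<F> \<Longrightarrow> clopenin X W"
    "\<And>W x y. W \<in> \<F> \<Longrightarrow> x \<in> W \<Longrightarrow> y \<in> W \<Longrightarrow> dist x y < e"
proof -
  have "\<exists>U. clopenin X U \<and> x \<in> U \<and> U \<subseteq> ball x (e/2)" if "x \<in> X" for x
  proof -
    have "openin (top_of_set X) (X \<inter> ball x (e/2))" "x \<in> X \<inter> ball x (e/2)"
      using that e by auto
    then show ?thesis
      by (metis X clopenin_neighbourhood le_inf_iff)
  qed
  then obtain U where U: "\<And>x. x \<in> X \<Longrightarrow> clopenin X (U x) \<and> x \<in> U x \<and> U x \<subseteq> ball x (e/2)"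
    by metis
  have "X \<subseteq> \<Union>(U ` X)" "\<And>W. W \<in> U ` X \<Longrightarrow> openin (top_of_set X) W"
    using U by (auto simp: clopenin_def)
  then obtain \<F> where F: "\<F> \<subseteq> U ` X" "finite \<F>" "X \<subseteq> \<Union>\<F>"
    using cantor_space_compact[OF X] unfolding compact_eq_openin_cover by metis
  show ?thesis
  proof (rule that[of \<F>])
    show "\<And>W. W \<in> \<F> \<Longrightarrow> clopenin X W" using F U by auto
    then show "\<Union>\<F> = X" using F clopenin_subset by blast
    fix W x y assume "W \<in> \<F>" and xy: "x \<in> W" "y \<in> W"
    then obtain z where "W \<subseteq> ball z (e/2)" using F U by blast
    then have "dist z x < e/2" "dist z y < e/2" using xy by auto
    then show "dist x y < e"
      by (metis dist_commute dist_triangle_half_r)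
  qed (use F in auto)
qed

lemma clopen_separating_sequence:
  fixes X :: "'a::metric_space set"
  assumes X: "cantor_space X"
  shows "\<exists>B :: nat \<Rightarrow> 'a set. (\<forall>n. clopenin X (B n)) \<and>
    (\<forall>x\<in>X. \<forall>y. x \<noteq> y \<longrightarrow> (\<exists>n. x \<in> B n \<and> y \<notin> B n))"
proof -
  have "\<exists>\<F>. finite \<F> \<and> \<Union>\<F> = X \<and> (\<forall>W\<in>\<F>. clopenin X W) \<and> 
     (\<forall>W\<in>\<F>. \<forall>x\<in>W. \<forall>y\<in>W. dist x y < inverse (real (Suc k)))" for k
    by (rule fine_clopen_cover[OF X, of "inverse (real (Suc k))"]) (simp, blast)
  then obtain \<F> where F: "\<And>k. finite (\<F> k)" "\<And>k. \<Union>(\<F> k) = X" "\<And>k W. W \<in> \<F> k \<Longrightarrow> clopenin X W"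
    "\<And>k W x y. W \<in> \<F> k \<Longrightarrow> x \<in> W \<Longrightarrow> y \<in> W \<Longrightarrow> dist x y < inverse (real (Suc k))"
    by metis
  \<comment> \<open>Inserting \<open>X\<close> keeps the family nonempty even for empty
    \<open>X\<close>, so that \<open>from_nat_into\<close> enumerates exactly its members.\<close>
  define \<G> where "\<G> = insert X (\<Union>k. \<F> k)"
  have G: "countable \<G>" "\<G> \<noteq> {}"
    using F(1) by (auto simp: \<G>_def intro: countable_finite)
  have ran: "range (from_nat_into \<G>) = \<G>"
    using G by (simp add: range_from_nat_into)
  show ?thesis
  proof (intro exI[of _ "from_nat_into \<G>"] conjI ballI allI impI)
    show "clopenin X (from_nat_into \<G> n)" for n
    proof -
      have "from_nat_into \<G> n \<in> \<G>" using G by (simp add: from_nat_into)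
      then show ?thesis using F by (auto simp: \<G>_def)
    qed
    fix x y assume x: "x \<in> X" "x \<noteq> y"
    then obtain k where k: "inverse (real (Suc k)) < dist x y"
      using reals_Archimedean[of "dist x y"] by auto
    obtain W where W: "W \<in> \<F> k" "x \<in> W" using x F by blast
    then have "y \<notin> W" using F(4)[of W k x y] k by auto
    moreover have "W \<in> \<G>" using W by (auto simp: \<G>_def)
    ultimately show "\<exists>n. x \<in> from_nat_into \<G> n \<and> y \<notin> from_nat_into \<G> n"
      using W ran by (metis imageE)
  qed
qed

lemma compact_nested_Inter_nonempty:
  fixes F :: "nat \<Rightarrow> 'a::t2_space set"
  assumes "\<And>n. compact (F n)" "\<And>n. F n \<noteq> {}" "\<And>n. F (Suc n) \<subseteq> F n"
  shows "(\<Inter>n. F n) \<noteq> {}"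
proof -
  have dec: "F n \<subseteq> F m" if "m \<le> n" for m n
    using assms(3) that by (rule lift_Suc_antimono_le)
  have "F 0 \<inter> (\<Inter>n\<in>UNIV. F n) \<noteq> {}"
  proof (rule compact_imp_fip_image)
    show "compact (F 0)" by (rule assms)
    show "closed (F i)" for i using assms(1) compact_imp_closed by blast
    fix I :: "nat set" assume "finite I"
    then obtain m where "I \<subseteq> {..m}" using finite_nat_iff_bounded_le by auto
    then have "F m \<subseteq> F 0 \<inter> (\<Inter>n\<in>I. F n)" using dec by blast
    then show "F 0 \<inter> (\<Inter>n\<in>I. F n) \<noteq> {}" using assms(2)[of m] by blast
  qed
  then show ?thesis by auto
qed

lemma continuous_on_locally_constant:
  assumes "\<And>x. x \<in> S \<Longrightarrow> \<exists>U. openin (top_of_set S) U \<and> x \<in> U \<and> (\<forall>y\<in>U. f y = f x)"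
  shows "continuous_on S f"
  unfolding continuous_on_def
proof
  fix x assume "x \<in> S"
  then obtain T where T: "open T" "x \<in> T" "\<forall>y\<in>S \<inter> T. f y = f x"
    using assms by (metis IntE openin_open)
  then have "eventually (\<lambda>y. f y = f x) (at x within S)"
    unfolding eventually_at_topological by blast
  then show "(f \<longlongrightarrow> f x) (at x within S)"
    by (rule tendsto_eventually)
qed

section \<open>Brouwer's characterisation by binary coding\<close>

definition bitseqs :: "(nat \<Rightarrow> real) set" where
  "bitseqs = {s. \<forall>n. s n \<in> {0, 1}}"

text \<open>Prescribing the code of one point costs nothing, since every cutting set may be taken to
  contain \<open>p\<close>. It is what later allows a homeomorphism of two Cantor spaces to match
  given points.\<close>

theorem cantor_space_homeomorphism_bitseqs:
  fixes U :: "'a::metric_space set"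
  assumes U: "cantor_space U" and p: "p \<in> U"
  obtains f g where "homeomorphism U bitseqs f g" "f p = (\<lambda>_. 1)"
proof -
  obtain B :: "nat \<Rightarrow> 'a set" where B': "\<forall>n. clopenin U (B n)"
    "\<forall>x\<in>U. \<forall>y. x \<noteq> y \<longrightarrow> (\<exists>n. x \<in> B n \<and> y \<notin> B n)"
    using clopen_separating_sequence[OF U] by (elim exE conjE) (rule that)
  have B: "clopenin U (B n)" for n
    using B'(1) by simp
  have Bsep: "\<exists>n. x \<in> B n \<and> y \<notin> B n" if "x \<in> U" "x \<noteq> y" for x y
    using B'(2) that by simp
  \<comment> \<open>At level \<open>n\<close> every piece \<open>E\<close> is cut in two, by \<open>B n\<close> whenever \<open>B n\<close> cuts it at all;
    as the \<open>B n\<close> separate points, the resulting itineraries determine the points.\<close>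
  define splits where "splits E n S \<longleftrightarrow> clopenin U S \<and> E \<inter> S \<noteq> {} \<and> E - S \<noteq> {} \<and> p \<in> S
      \<and> (E \<inter> B n \<noteq> {} \<and> E - B n \<noteq> {} \<longrightarrow> S = B n \<or> S = U - B n)" for E n S
  have ex_split: "\<exists>S. splits E n S"
    if E: "clopenin U E" "E \<noteq> {}" for E n
  proof -
    obtain S where S: "clopenin U S" "E \<inter> S \<noteq> {}" "E - S \<noteq> {}"
      "(E \<inter> B n \<noteq> {} \<and> E - B n \<noteq> {} \<longrightarrow> S = B n \<or> S = U - B n)"
    proof (cases "E \<inter> B n \<noteq> {} \<and> E - B n \<noteq> {}")
      case True
      then show ?thesis using that[of "B n"] B[of n] by blast
    next
      case False
      \<comment> \<open>\<open>B n\<close> does not cut \<open>E\<close> here, so a set separating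
        two points of \<open>E\<close> replaces it. Both halves must be nonempty for every bit
        sequence to occur as a code.\<close>
      have inf: "infinite E"
        using E U cantor_space_openin_infinite by (auto simp: clopenin_def)
      obtain x where x: "x \<in> E" using E(2) by blast
      have "infinite (E - {x})" using inf by simp
      then obtain y where "y \<in> E - {x}" by (metis ex_in_conv finite.emptyI)
      with x have xy: "x \<in> E" "y \<in> E" "x \<noteq> y" by auto
      then obtain m where "x \<in> B m" "y \<notin> B m"
        using Bsep[of x y] clopenin_subset[OF E(1)] by blast
      then show ?thesis using that[of "B m"] B[of m] False xy by blast
    qed
    \<comment> \<open>Passing to the complement puts \<open>p\<close> on the chosen side and merely
      exchanges the two halves.\<close>
    show ?thesis
    proof (cases "p \<in> S")
      case True then show ?thesis using S unfolding splits_def by auto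
    next
      case False
      have "E \<inter> (U - S) \<noteq> {}" "E - (U - S) \<noteq> {}"
        using S clopenin_subset[OF E(1)] by auto
      moreover have "clopenin U (U - S)" using S(1) by (simp add: clopenin_Diff)
      moreover have "U - S = B n \<or> U - S = U - B n" if "E \<inter> B n \<noteq> {} \<and> E - B n \<noteq> {}"
        using S(4) that clopenin_subset[OF B[of n]] by blast
      ultimately have "splits E n (U - S)" using False p unfolding splits_def by blast
      then show ?thesis by blast
    qed
  qed
  define S where "S E n = (SOME S. splits E n S)" for E n
  have S: "splits E n (S E n)" if "clopenin U E" "E \<noteq> {}" for E n
    unfolding S_def using someI_ex[OF ex_split[OF that]] .
  define E where "E = (\<lambda>s::nat\<Rightarrow>real. rec_nat U (\<lambda>n A. if s n = 1 then A \<inter> S A n else A - S A n))"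
  have E0: "E s 0 = U" and ES: "E s (Suc n) = (if s n = 1 then E s n \<inter> S (E s n) n else E s n - S (E s n) n)" for s n
    by (auto simp: E_def)
  have Ecl: "clopenin U (E s n) \<and> E s n \<noteq> {}" for s n
  proof (induction n)
    case 0
    then show ?case using p by (auto simp: E0)
  next
    case (Suc n)
    then have "splits (E s n) n (S (E s n) n)" by (intro S) auto
    then show ?case using Suc
      by (auto simp: splits_def ES intro: clopenin_Int clopenin_Diff)
  qed
  have "splits (E s n) n (S (E s n) n)" for s n
    by (intro S) (auto simp: Ecl)
  then have SE: "clopenin U (S (E s n) n)" "p \<in> S (E s n) n"
       "E s n \<inter> B n \<noteq> {} \<Longrightarrow> E s n - B n \<noteq> {} \<Longrightarrow> S (E s n) n = B n \<or> S (E s n) n = U - B n" for s n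
    unfolding splits_def by auto
  \<comment> \<open>\<open>E s n\<close> is the piece addressed by a prescribed code
    \<open>s\<close>, \<open>D x n\<close> the piece that contains the point \<open>x\<close>, and
    \<open>F x\<close> the code read off along the way.\<close>
  define D where "D = (\<lambda>x. rec_nat U (\<lambda>n A. if x \<in> S A n then A \<inter> S A n else A - S A n))"
  define F where "F = (\<lambda>x n. if x \<in> S (D x n) n then 1 else 0::real)"
  have D0: "D x 0 = U" and DS: "D x (Suc n) = (if x \<in> S (D x n) n then D x n \<inter> S (D x n) n else D x n - S (D x n) n)" for x n
    by (auto simp: D_def)
  have F1: "F x n = (if x \<in> S (D x n) n then 1 else 0)" for x n
    by (simp add: F_def)
  have DE: "D x n = E (F x) n" for x n
  proof (induction n)
    case 0
    then show ?case by (simp add: E0 D0)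
  next
    case (Suc n)
    then show ?case
      by (cases "x \<in> S (D x n) n") (simp_all only: ES DS F1 if_True if_False refl zero_neq_one not_False_eq_True)
  qed
  have xD: "x \<in> D x n" if "x \<in> U" for x n
    using that by (induction n) (auto simp: D0 DS)
  have Fb: "F x \<in> bitseqs" for x by (auto simp: bitseqs_def F_def)
  have code: "(\<forall>m<n. F y m = s m) \<and> D y n = E s n" if "y \<in> E s n" "s \<in> bitseqs" for y s n
    using that(1)
  proof (induction n)
    case 0 then show ?case by (simp add: D0 E0)
  next
    case (Suc n)
    then have "y \<in> E s n" by (auto simp: ES split: if_splits)
    then have IH: "\<forall>m<n. F y m = s m" "D y n = E s n" using Suc by auto
    have "s n = 1 \<or> s n = 0" using that(2) by (auto simp: bitseqs_def)
    then have "F y n = s n" using Suc.prems IH(2) by (simp only: F1 ES split: if_splits) auto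
    moreover have "D y (Suc n) = E s (Suc n)"
      using Suc.prems IH(2) by (simp only: DS ES split: if_splits) auto
    ultimately show ?case using IH less_Suc_eq by auto
  qed
  have cont: "continuous_on U F"
  proof (rule continuous_on_coordinatewise_then_product)
    fix n
    show "continuous_on U (\<lambda>x. F x n)"
    proof (rule continuous_on_locally_constant)
      fix x assume "x \<in> U"
      then have "x \<in> E (F x) (Suc n)" using xD[of x "Suc n"] DE by simp
      moreover have "openin (top_of_set U) (E (F x) (Suc n))"
        using Ecl by (simp add: clopenin_def)
      moreover have "F y n = F x n" if "y \<in> E (F x) (Suc n)" for y
        using code[OF that Fb] by blast
      ultimately show "\<exists>V. openin (top_of_set U) V \<and> x \<in> V \<and> (\<forall>y\<in>V. F y n = F x n)"
        by blast
    qed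
  qed
  \<comment> \<open>Equal codes keep \<open>x\<close> and \<open>y\<close> in a common piece at
    every level. At a level whose \<open>B n\<close> separates them the cut is \<open>B n\<close> or
    its complement, and digit \<open>n\<close> differs.\<close>
  have inj: "inj_on F U"
  proof (rule inj_onI, rule ccontr)
    fix x y assume xy: "x \<in> U" "y \<in> U" "F x = F y" "x \<noteq> y"
    then obtain n where n: "x \<in> B n" "y \<notin> B n" using Bsep[of x y] by blast
    have in_E: "x \<in> E (F x) n" "y \<in> E (F x) n"
      using xD[OF xy(1), of n] xD[OF xy(2), of n] xy(3) DE by auto
    then have "S (E (F x) n) n = B n \<or> S (E (F x) n) n = U - B n"
      using SE(3)[of "F x" n] n by blast
    moreover have "z \<in> S (E (F z) n) n \<longleftrightarrow> F z n = 1" for z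
      by (simp add: F1 DE[symmetric])
    ultimately show False using n xy by (metis Diff_iff)
  qed
  have surj: "F ` U = bitseqs"
  proof
    show "F ` U \<subseteq> bitseqs" using Fb by auto
    show "bitseqs \<subseteq> F ` U"
    proof
      fix s assume s: "s \<in> bitseqs"
      have "(\<Inter>n. E s n) \<noteq> {}"
        using Ecl clopenin_compact[OF cantor_space_compact[OF U]]
        by (intro compact_nested_Inter_nonempty) (auto simp: ES)
      then obtain x where x: "\<And>n. x \<in> E s n" by auto
      have "F x m = s m" for m using code[OF x[of "Suc m"] s] by blast
      then have "F x = s" by (rule ext)
      moreover have "x \<in> U" using x[of 0] by (simp add: E0)
      ultimately show "s \<in> F ` U" by auto
    qed
  qed
  have "F p n = 1" for n
    using SE(2)[of "F p" n] by (simp add: F1 DE)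
  then have "F p = (\<lambda>_. 1)" by (rule ext)
  then show ?thesis
    using homeomorphism_compact[OF cantor_space_compact[OF U] cont surj inj] that by blast
qed

corollary cantor_spaces_pointed_homeomorphism:
  assumes "cantor_space U" "p \<in> U" "cantor_space V" "q \<in> V"
  obtains f g where "homeomorphism U V f g" "f p = q"
proof -
  obtain f1 g1 f2 g2 where 1: "homeomorphism U bitseqs f1 g1" "f1 p = (\<lambda>_. 1)"
    and 2: "homeomorphism V bitseqs f2 g2" "f2 q = (\<lambda>_. 1)"
    using cantor_space_homeomorphism_bitseqs assms by metis
  have "homeomorphism U V (g2 \<circ> f1) (g1 \<circ> f2)"
    using homeomorphism_compose[OF 1(1) homeomorphism_symD[OF 2(1)]] by auto
  moreover have "(g2 \<circ> f1) p = q"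
    using 1 2 assms by (metis comp_apply homeomorphism_apply1)
  ultimately show ?thesis using that by blast
qed

section \<open>Homeomorphisms, clopen partitions and shadowing\<close>

lemma homeos_iff:
  fixes f :: "'a::t2_space \<Rightarrow> 'a"
  assumes "compact X"
  shows "f \<in> homeos X \<longleftrightarrow> continuous_on X f \<and> bij_betw f X X"
proof
  assume "f \<in> homeos X"
  then obtain g where "homeomorphism X X f g" by (auto simp: homeos_def)
  then show "continuous_on X f \<and> bij_betw f X X"
    by (auto simp: homeomorphism_def bij_betw_def intro: inj_on_inverseI[of _ g])
next
  assume "continuous_on X f \<and> bij_betw f X X"
  then show "f \<in> homeos X"
    using homeomorphism_compact[OF assms, of f X] by (auto simp: homeos_def bij_betw_def)
qed

lemma homeos_image: "f \<in> homeos X \<Longrightarrow> f ` X = X"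
  by (auto simp: homeos_def homeomorphism_def)

lemma homeos_inj_on: "f \<in> homeos X \<Longrightarrow> inj_on f X"
  by (auto simp: homeos_def homeomorphism_def intro: inj_on_inverseI)

lemma homeos_continuous_on: "f \<in> homeos X \<Longrightarrow> continuous_on X f"
  by (auto simp: homeos_def homeomorphism_def)

lemma homeos_mem: "f \<in> homeos X \<Longrightarrow> x \<in> X \<Longrightarrow> f x \<in> X"
  using homeos_image by blast

lemma homeos_id: "(\<lambda>x. x) \<in> homeos X"
  unfolding homeos_def using homeomorphism_ident by auto

lemma homeos_comp: "f \<in> homeos X \<Longrightarrow> g \<in> homeos X \<Longrightarrow> g \<circ> f \<in> homeos X"
  unfolding homeos_def using homeomorphism_compose by blast

lemma homeos_inv_into:
  fixes f :: "'a::t2_space \<Rightarrow> 'a"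
  assumes X: "compact X" and f: "f \<in> homeos X"
  shows "inv_into X f \<in> homeos X"
proof -
  obtain g where g: "homeomorphism X X f g" using f by (auto simp: homeos_def)
  have "inv_into X f x = g x" if "x \<in> X" for x
  proof (rule inv_into_f_eq[OF homeos_inj_on[OF f]])
    show "g x \<in> X" "f (g x) = x" using that g by (auto simp: homeomorphism_def)
  qed
  then have "homeomorphism X X (inv_into X f) f"
    using homeomorphism_symD[OF g] homeomorphism_cong[of X X g f X X "inv_into X f" f] by auto
  then show ?thesis by (auto simp: homeos_def)
qed

text \<open>Empty pieces are allowed, so a complement may serve as the last piece without checking
  whether anything is left in it.\<close>

lemma homeos_glue:
  fixes X :: "'a::t2_space set"
  assumes "compact X" "finite I" and A: "\<And>i. i \<in> I \<Longrightarrow> compact (A i)" "(\<Union>i\<in>I. A i) = X" "disjoint_family_on A I"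
    and B: "(\<Union>i\<in>I. B i) = X" "disjoint_family_on B I"
    and hom: "\<And>i. i \<in> I \<Longrightarrow> homeomorphism (A i) (B i) (\<phi> i) (\<psi> i)"
  shows "\<exists>h\<in>homeos X. \<forall>i\<in>I. \<forall>x\<in>A i. h x = \<phi> i x"
proof -
  define h where "h x = \<phi> (THE i. i \<in> I \<and> x \<in> A i) x" for x
  have h: "h x = \<phi> i x" if "i \<in> I" "x \<in> A i" for i x
  proof -
    have "(THE i. i \<in> I \<and> x \<in> A i) = i"
      using that A(3) unfolding disjoint_family_on_def by (intro the_equality) blast+
    then show ?thesis by (simp add: h_def)
  qed
  have "continuous_on (\<Union>i\<in>I. A i) h"
  proof (rule continuous_on_closed_Union[OF \<open>finite I\<close>])
    fix i assume i: "i \<in> I"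
    then show "closed (A i)" using A(1) compact_imp_closed by blast
    have "continuous_on (A i) (\<phi> i)" using hom[OF i] by (auto simp: homeomorphism_def)
    then show "continuous_on (A i) h" using h[OF i] by (metis continuous_on_cong)
  qed
  moreover have "bij_betw h (\<Union>i\<in>I. A i) (\<Union>i\<in>I. B i)"
  proof (rule bij_betw_UNION_disjoint[OF B(2)])
    fix i assume i: "i \<in> I"
    have "bij_betw (\<phi> i) (A i) (B i)"
      using hom[OF i] by (auto simp: homeomorphism_def bij_betw_def intro: inj_on_inverseI)
    then show "bij_betw h (A i) (B i)" using h[OF i] by (metis bij_betw_cong)
  qed
  ultimately have "h \<in> homeos X"
    using A B homeos_iff[OF \<open>compact X\<close>] by auto
  then show ?thesis using h by blast
qed

text \<open>No relation between the sizes of \<open>A i\<close> and \<open>B i\<close> is required,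
  since all nonempty clopen sets are homeomorphic. This supplies the north-south maps of the
  cells.\<close>

lemma homeos_rearrange_clopen_pieces:
  fixes X :: "'a::metric_space set"
  assumes X: "cantor_space X" and "finite I"
    and A: "\<And>i. i \<in> I \<Longrightarrow> clopenin X (A i) \<and> A i \<noteq> {}" "(\<Union>i\<in>I. A i) = X" "disjoint_family_on A I"
    and B: "\<And>i. i \<in> I \<Longrightarrow> clopenin X (B i) \<and> B i \<noteq> {}" "(\<Union>i\<in>I. B i) = X" "disjoint_family_on B I"
  shows "\<exists>h\<in>homeos X. \<forall>i\<in>I. h ` A i = B i"
proof -
  have "\<exists>\<phi> \<psi>. homeomorphism (A i) (B i) \<phi> \<psi>" if i: "i \<in> I" for i
  proof -
    obtain p q where "p \<in> A i" "q \<in> B i" using A(1)[OF i] B(1)[OF i] by blast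
    then show ?thesis
      using cantor_spaces_pointed_homeomorphism[of "A i" p "B i" q] cantor_space_clopenin[OF X] A(1)[OF i] B(1)[OF i]
      by metis
  qed
  then obtain \<phi> \<psi> where hom: "\<And>i. i \<in> I \<Longrightarrow> homeomorphism (A i) (B i) (\<phi> i) (\<psi> i)"
    by metis
  have com: "\<And>i. i \<in> I \<Longrightarrow> compact (A i)"
    using A(1) clopenin_compact cantor_space_compact[OF X] by blast
  obtain h where h: "h \<in> homeos X" "\<forall>i\<in>I. \<forall>x\<in>A i. h x = \<phi> i x"
    using homeos_glue[OF cantor_space_compact[OF X] \<open>finite I\<close> com A(2,3) B(2,3) hom] by blast
  have "h ` A i = B i" if "i \<in> I" for i
  proof -
    have "h ` A i = \<phi> i ` A i" using h(2) that by auto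
    then show ?thesis using hom[OF that] by (auto simp: homeomorphism_def)
  qed
  then show ?thesis using h by blast
qed

section \<open>Clopen partitions and closeness of homeomorphisms\<close>

definition clopen_partition :: "'a::topological_space set \<Rightarrow> 'a set set \<Rightarrow> bool" where
  "clopen_partition X \<P> \<longleftrightarrow> finite \<P> \<and> \<Union>\<P> = X \<and> disjoint \<P> \<and> (\<forall>P\<in>\<P>. clopenin X P \<and> P \<noteq> {})"

definition cell :: "'a set set \<Rightarrow> 'a \<Rightarrow> 'a set" where
  "cell \<P> x = (THE P. P \<in> \<P> \<and> x \<in> P)"

lemma cell_eq: "clopen_partition X \<P> \<Longrightarrow> P \<in> \<P> \<Longrightarrow> x \<in> P \<Longrightarrow> cell \<P> x = P"
  unfolding cell_def clopen_partition_def disjoint_def by (intro the_equality) blast+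

lemma cell_mem: "clopen_partition X \<P> \<Longrightarrow> x \<in> X \<Longrightarrow> cell \<P> x \<in> \<P> \<and> x \<in> cell \<P> x"
  using cell_eq unfolding clopen_partition_def by (metis UnionE)

text \<open>The cells are the atoms generated by a fine clopen cover: points are identified when
  they lie in the same members. An atom is contained in a member and inherits its diameter
  bound.\<close>

lemma fine_clopen_partition:
  assumes X: "cantor_space X" and e: "e > 0"
  obtains \<P> where "clopen_partition X \<P>" "\<And>P x y. P \<in> \<P> \<Longrightarrow> x \<in> P \<Longrightarrow> y \<in> P \<Longrightarrow> dist x y < e"
proof -
  obtain \<F> where F: "finite \<F>" "\<Union>\<F> = X" "\<And>W. W \<in> \<F> \<Longrightarrow> clopenin X W"
    "\<And>W x y. W \<in> \<F> \<Longrightarrow> x \<in> W \<Longrightarrow> y \<in> W \<Longrightarrow> dist x y < e"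
    using fine_clopen_cover[OF X e] by metis
  define c where "c x = {W\<in>\<F>. x \<in> W}" for x
  define \<P> where "\<P> = (\<lambda>x. {y\<in>X. c y = c x}) ` X"
  have "\<P> = (\<lambda>C. {y\<in>X. c y = C}) ` c ` X" by (auto simp: \<P>_def)
  moreover have "c ` X \<subseteq> Pow \<F>" by (auto simp: c_def)
  ultimately have fin: "finite \<P>" using F(1) by (metis finite_Pow_iff finite_imageI finite_subset)
  have cl: "clopenin X {y\<in>X. c y = c x}" if "x \<in> X" for x
  proof -
    have "{y\<in>X. c y = c x} = (\<Inter>W\<in>\<F>. if x \<in> W then W else X - W)"
      using F(2) that by (auto simp: c_def split: if_splits)
    moreover have "\<F> \<noteq> {}" using F(2) that by auto
    moreover have "clopenin X (\<Inter>W\<in>\<F>. if x \<in> W then W else X - W)"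
      using F(1,3) \<open>\<F> \<noteq> {}\<close> by (intro clopenin_INT) (auto intro: clopenin_Diff)
    ultimately show ?thesis by simp
  qed
  show ?thesis
  proof (rule that[of \<P>])
    show "clopen_partition X \<P>"
      unfolding clopen_partition_def disjoint_def using fin cl by (auto simp: \<P>_def)
    fix P x y assume P: "P \<in> \<P>" "x \<in> P" "y \<in> P"
    then have "x \<in> X" "c x = c y" by (auto simp: \<P>_def)
    moreover obtain W where "W \<in> \<F>" "x \<in> W" using \<open>x \<in> X\<close> F(2) by auto
    ultimately have "W \<in> \<F>" "x \<in> W" "y \<in> W" by (auto simp: c_def)
    then show "dist x y < e" using F(4) by blast
  qed
qed

text \<open>A numbering of the cells is locally constant, hence uniformly continuous by compactness,
  and natural numbers at distance below 1 coincide. Halving \<open>d\<close> turns the strict bound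
  into a non-strict one, as in the definition of shadowing.\<close>

lemma clopen_partition_gap:
  fixes X :: "'a::metric_space set"
  assumes X: "compact X" and P: "clopen_partition X \<P>"
  obtains d where "d > 0" "\<And>x y. x \<in> X \<Longrightarrow> y \<in> X \<Longrightarrow> dist x y \<le> d \<Longrightarrow> cell \<P> x = cell \<P> y"
proof -
  obtain idx :: "'a set \<Rightarrow> nat" where idx: "inj_on idx \<P>"
    using P finite_imp_inj_to_nat_seg[of \<P>] unfolding clopen_partition_def by blast
  define c where "c x = real (idx (cell \<P> x))" for x
  have "continuous_on X c"
  proof (rule continuous_on_locally_constant)
    fix x assume x: "x \<in> X"
    have C: "cell \<P> x \<in> \<P>" "x \<in> cell \<P> x" using cell_mem[OF P x] by auto
    have "openin (top_of_set X) (cell \<P> x)"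
      using C P by (auto simp: clopen_partition_def clopenin_def)
    moreover have "c y = c x" if "y \<in> cell \<P> x" for y
      using cell_eq[OF P C(1) that] by (simp add: c_def)
    ultimately show "\<exists>U. openin (top_of_set X) U \<and> x \<in> U \<and> (\<forall>y\<in>U. c y = c x)"
      using C by blast
  qed
  then have "uniformly_continuous_on X c"
    using X compact_uniformly_continuous by blast
  then obtain d where d: "d > 0" "\<And>x y. x \<in> X \<Longrightarrow> y \<in> X \<Longrightarrow> dist y x < d \<Longrightarrow> dist (c y) (c x) < 1"
    unfolding uniformly_continuous_on_def using zero_less_one by blast
  show ?thesis
  proof (rule that[of "d/2"])
    fix x y assume xy: "x \<in> X" "y \<in> X" "dist x y \<le> d/2"
    then have "dist (c y) (c x) < 1" using d(1) by (intro d(2)) (auto simp: dist_commute)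
    then have "idx (cell \<P> x) = idx (cell \<P> y)" by (auto simp: c_def dist_real_def)
    then show "cell \<P> x = cell \<P> y" using inj_onD[OF idx] cell_mem[OF P] xy(1,2) by blast
  qed (use d in auto)
qed

text \<open>The inverses are controlled without any hypothesis on them: if \<open>g x = y\<close>,
  then \<open>f x\<close> lies in the cell of \<open>y\<close>, and uniform continuity of the
  inverse of \<open>f\<close> brings its value at \<open>y\<close> close to \<open>x\<close>, the
  value of the inverse of \<open>g\<close>.\<close>

lemma Dhom_less_if_same_cells:
  fixes X :: "'a::metric_space set"
  assumes X: "cantor_space X" "X \<noteq> {}" and f: "f \<in> homeos X" and e: "e > 0"
  shows "\<exists>\<P>. clopen_partition X \<P> \<and>
    (\<forall>g\<in>homeos X. (\<forall>x\<in>X. cell \<P> (g x) = cell \<P> (f x)) \<longrightarrow> Dhom X f g < e)"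
proof -
  have cX: "compact X" using X cantor_space_compact by blast
  let ?f' = "inv_into X f"
  have f': "?f' \<in> homeos X" using homeos_inv_into[OF cX f] .
  have "uniformly_continuous_on X ?f'"
    using compact_uniformly_continuous homeos_continuous_on[OF f'] cX by blast
  then obtain d where d: "d > 0" "\<And>x y. x \<in> X \<Longrightarrow> y \<in> X \<Longrightarrow> dist y x < d \<Longrightarrow> dist (?f' y) (?f' x) < e/2"
    unfolding uniformly_continuous_on_def using half_gt_zero[OF e] by blast
  \<comment> \<open>Cell diameters below \<open>e/2\<close> compare \<open>f\<close> with
    \<open>g\<close>, those below \<open>d\<close> compare the inverses. The half leaves the
    inequality strict after taking suprema.\<close>
  define m where "m = min d (e/2)"
  have m: "m > 0" "m \<le> d" "m \<le> e/2" using d e by (auto simp: m_def)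
  obtain \<P> where P: "clopen_partition X \<P>"
    "\<And>P x y. P \<in> \<P> \<Longrightarrow> x \<in> P \<Longrightarrow> y \<in> P \<Longrightarrow> dist x y < m"
    using fine_clopen_partition[OF X(1) m(1)] by metis
  have close: "dist x y < m" if "x \<in> X" "y \<in> X" "cell \<P> x = cell \<P> y" for x y
    using P(2)[of "cell \<P> x" x y] cell_mem[OF P(1) that(1)] cell_mem[OF P(1) that(2)] that(3) by simp
  show ?thesis
  proof (intro exI[of _ \<P>] conjI ballI impI)
    show "clopen_partition X \<P>" by (rule P(1))
    fix g assume g: "g \<in> homeos X" and same: "\<forall>x\<in>X. cell \<P> (g x) = cell \<P> (f x)"
    have "dC0 X f g \<le> e/2"
      unfolding dC0_def
    proof (rule cSUP_least[OF X(2)])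
      fix x assume x: "x \<in> X"
      then have "dist (f x) (g x) < m"
        using same homeos_mem[OF f x] homeos_mem[OF g x] by (intro close) auto
      then show "dist (f x) (g x) \<le> e/2" using m by simp
    qed
    moreover have "dC0 X ?f' (inv_into X g) \<le> e/2"
      unfolding dC0_def
    proof (rule cSUP_least[OF X(2)])
      fix y assume y: "y \<in> X"
      define x where "x = inv_into X g y"
      have x: "x \<in> X" "g x = y"
        using y homeos_image[OF g] unfolding x_def by (auto intro: inv_into_into f_inv_into_f)
      have "dist y (f x) < m"
        using close[of "g x" "f x"] same x y homeos_mem[OF f x(1)] by auto
      then have "dist (?f' y) (?f' (f x)) < e/2"
        using d(2)[of "f x" y] y homeos_mem[OF f x(1)] m by auto
      moreover have "?f' (f x) = x" using x homeos_inj_on[OF f] by simp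
      ultimately show "dist (?f' y) (inv_into X g y) \<le> e/2" by (simp add: x_def)
    qed
    ultimately show "Dhom X f g < e" using e by (auto simp: Dhom_def)
  qed
qed

section \<open>Moving finitely many points within cells\<close>

lemma homeos_move_point:
  fixes X :: "'a::metric_space set"
  assumes X: "cantor_space X" and C: "clopenin X C" and pq: "p \<in> C" "q \<in> C"
    and E: "finite E" "p \<notin> E" "q \<notin> E"
  obtains h where "h \<in> homeos X" "h p = q" "\<And>x. x \<in> E \<inter> X \<Longrightarrow> h x = x" "\<And>x. x \<in> X - C \<Longrightarrow> h x = x"
proof (cases "p = q")
  case True
  then show ?thesis using that[OF homeos_id] by auto
next
  case False
  have cX: "compact X" using X cantor_space_compact by blast
  have oC: "openin (top_of_set X) C" using C by (simp add: clopenin_def)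
  have op: "openin (top_of_set X) (C - F)" if "closed F" for F
  proof -
    have "C - F = C \<inter> (X \<inter> - F)" using clopenin_subset[OF C] by auto
    then show ?thesis using oC that by (simp add: open_Compl openin_open_Int openin_Int)
  qed
  obtain U where U: "clopenin X U" "p \<in> U" "U \<subseteq> C - insert q E"
    using clopenin_neighbourhood[OF X op[of "insert q E"], of p] pq E False
    by (auto simp: finite_imp_closed)
  have "closed (U \<union> E)" using U cX E by (intro closed_Un compact_imp_closed[of U] clopenin_compact[OF cX] finite_imp_closed)
  then obtain V where V: "clopenin X V" "q \<in> V" "V \<subseteq> C - (U \<union> E)"
    using clopenin_neighbourhood[OF X op[of "U \<union> E"], of q] pq E U by auto
  obtain \<phi> \<psi> where \<phi>: "homeomorphism U V \<phi> \<psi>" "\<phi> p = q"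
    using cantor_spaces_pointed_homeomorphism[of U p V q] cantor_space_clopenin[OF X] U V by metis
  \<comment> \<open>The homeomorphism swaps two disjoint clopen neighbourhoods \<open>U\<close> of
    \<open>p\<close> and \<open>V\<close> of \<open>q\<close> inside \<open>C\<close>, both missing
    \<open>E\<close>, and fixes everything else.\<close>
  define A where "A = (\<lambda>i::nat. if i = 0 then U else if i = 1 then V else X - (U \<union> V))"
  define B where "B = (\<lambda>i::nat. if i = 0 then V else if i = 1 then U else X - (U \<union> V))"
  define F where "F = (\<lambda>i::nat. if i = 0 then \<phi> else if i = 1 then \<psi> else (\<lambda>x. x))"
  define G where "G = (\<lambda>i::nat. if i = 0 then \<psi> else if i = 1 then \<phi> else (\<lambda>x. x))"
  have UV: "U \<subseteq> X" "V \<subseteq> X" "U \<inter> V = {}" using V(3) clopenin_subset[OF U(1)] clopenin_subset[OF V(1)] by auto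
  have "\<exists>h\<in>homeos X. \<forall>i\<in>{0,1,2}. \<forall>x\<in>A i. h x = F i x"
  proof (rule homeos_glue[OF cX, of "{0,1,2}" A B F G])
    show "compact (A i)" if "i \<in> {0,1,2}" for i
    proof (rule clopenin_compact[OF cX])
      show "clopenin X (A i)"
        using U(1) V(1) by (simp add: A_def clopenin_Diff clopenin_Un)
    qed
    show "homeomorphism (A i) (B i) (F i) (G i)" if "i \<in> {0,1,2}" for i
      using \<phi>(1) homeomorphism_symD[OF \<phi>(1)] by (simp add: A_def B_def F_def G_def homeomorphism_ident)
    show "(\<Union>i\<in>{0,1,2}. A i) = X" "(\<Union>i\<in>{0,1,2}. B i) = X"
      using UV by (auto simp: A_def B_def)
    show "disjoint_family_on A {0,1,2}" "disjoint_family_on B {0,1,2}"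
      using UV by (auto simp: A_def B_def disjoint_family_on_def)
  qed (use cX in auto)
  then obtain h where h: "h \<in> homeos X" "\<forall>i\<in>{0,1,2}. \<forall>x\<in>A i. h x = F i x" by blast
  have fix_out: "h x = x" if "x \<in> X" "x \<notin> U" "x \<notin> V" for x
    using bspec[OF bspec[OF h(2), of 2], of x] that by (simp add: A_def F_def)
  show ?thesis
  proof (rule that[OF h(1)])
    show "h p = q" using bspec[OF bspec[OF h(2), of 0], of p] U(2) \<phi>(2) by (simp add: A_def F_def)
    show "h x = x" if "x \<in> E \<inter> X" for x
      using that U V by (intro fix_out) auto
    show "h x = x" if "x \<in> X - C" for x
      using that U V by (intro fix_out) auto
  qed
qed

text \<open>A point leaving \<open>C\<close> would land on a fixed point and share its image with
  it, against injectivity.\<close>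

lemma homeos_cell_preserving_if_supported:
  assumes P: "clopen_partition X \<P>" and "C \<in> \<P>" and h: "h \<in> homeos X" "\<And>x. x \<in> X - C \<Longrightarrow> h x = x"
    and x: "x \<in> X"
  shows "cell \<P> (h x) = cell \<P> x"
proof (cases "x \<in> C")
  case True
  have "h x \<in> C"
  proof (rule ccontr)
    assume "h x \<notin> C"
    then have "h (h x) = h x" using h homeos_mem x by blast
    then have "h x = x" using inj_onD[OF homeos_inj_on[OF h(1)], of "h x" x] homeos_mem[OF h(1)] x by auto
    then show False using True \<open>h x \<notin> C\<close> by auto
  qed
  then show ?thesis using True cell_eq[OF P] \<open>C \<in> \<P>\<close> by simp
next
  case False
  then show ?thesis using h x by auto
qed

text \<open>The points are moved one at a time, because sources and targets may overlap. By
  injectivity the current position \<open>h (a N)\<close> is not one of the targets already reached,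
  so the next move can fix all of those.\<close>

lemma homeos_move_points_in_cells:
  fixes X :: "'a::metric_space set" and a b :: "nat \<Rightarrow> 'a"
  assumes X: "cantor_space X" and P: "clopen_partition X \<P>"
    and "inj_on a {..<N}" "inj_on b {..<N}"
    and "\<And>i. i < N \<Longrightarrow> a i \<in> X" "\<And>i. i < N \<Longrightarrow> b i \<in> X" "\<And>i. i < N \<Longrightarrow> cell \<P> (a i) = cell \<P> (b i)"
  shows "\<exists>h\<in>homeos X. (\<forall>x\<in>X. cell \<P> (h x) = cell \<P> x) \<and> (\<forall>i<N. h (a i) = b i)"
  using assms(3-)
proof (induction N)
  case 0
  show ?case using homeos_id by (intro bexI[of _ "\<lambda>x. x"]) auto
next
  case (Suc N)
  have "inj_on a {..<N}" "inj_on b {..<N}"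
    using Suc.prems(1,2) by (auto simp: inj_on_def)
  then obtain h where h: "h \<in> homeos X" "\<And>x. x \<in> X \<Longrightarrow> cell \<P> (h x) = cell \<P> x" "\<And>i. i < N \<Longrightarrow> h (a i) = b i"
    using Suc by (metis less_SucI)
  define C where "C = cell \<P> (b N)"
  have bN: "b N \<in> X" "a N \<in> X" using Suc.prems by auto
  then have C: "C \<in> \<P>" "b N \<in> C" unfolding C_def using cell_mem[OF P] by auto
  then have cC: "clopenin X C" using P by (auto simp: clopen_partition_def)
  have "cell \<P> (h (a N)) = C" using h(2) bN Suc.prems(5)[of N] by (auto simp: C_def)
  then have hC: "h (a N) \<in> C" using cell_mem[OF P, of "h (a N)"] homeos_mem[OF h(1)] bN by auto
  have 1: "h (a N) \<notin> b ` {..<N}"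
  proof
    assume "h (a N) \<in> b ` {..<N}"
    then obtain i where i: "i < N" "h (a N) = h (a i)" using h(3) by auto
    then have "a N = a i" using inj_onD[OF homeos_inj_on[OF h(1)]] Suc.prems(3)[of i] bN by auto
    then show False using inj_onD[OF Suc.prems(1), of N i] i by auto
  qed
  have 2: "b N \<notin> b ` {..<N}"
  proof
    assume "b N \<in> b ` {..<N}"
    then obtain i where "i < N" "b N = b i" by auto
    then show False using inj_onD[OF Suc.prems(2), of N i] by auto
  qed
  obtain k where k: "k \<in> homeos X" "k (h (a N)) = b N" "\<And>x. x \<in> b ` {..<N} \<inter> X \<Longrightarrow> k x = x"
    "\<And>x. x \<in> X - C \<Longrightarrow> k x = x"
    using homeos_move_point[OF X cC hC C(2) _ 1 2] by auto
  have "k \<circ> h \<in> homeos X" using h k homeos_comp by blast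
  moreover have "cell \<P> ((k \<circ> h) x) = cell \<P> x" if "x \<in> X" for x
    using homeos_cell_preserving_if_supported[OF P C(1) k(1,4)] h that homeos_mem[OF h(1)] by auto
  moreover have "(k \<circ> h) (a i) = b i" if "i < Suc N" for i
    using that k(2,3) h(3) Suc.prems(4)[of i] less_antisym by (cases "i = N") auto
  ultimately show ?case by blast
qed

section \<open>Shadowing from stability\<close>

lemma distinct_choice_infinite_sets:
  fixes W :: "nat \<Rightarrow> 'a set"
  assumes "\<And>i. infinite (W i)"
  shows "\<exists>y. inj_on y {..n} \<and> (\<forall>i\<le>n. y i \<in> W i)"
proof (induction n)
  case 0
  obtain z where "z \<in> W 0" using assms[of 0] by (metis ex_in_conv finite.emptyI)
  then show ?case by (intro exI[of _ "\<lambda>_. z"]) auto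
next
  case (Suc n)
  then obtain y where y: "inj_on y {..n}" "\<forall>i\<le>n. y i \<in> W i" by blast
  have "infinite (W (Suc n) - y ` {..n})" using assms by (simp add: Diff_infinite_finite)
  then obtain z where z: "z \<in> W (Suc n)" "z \<notin> y ` {..n}" by (metis DiffE ex_in_conv finite.emptyI)
  have "inj_on (y(Suc n := z)) {..Suc n}"
    using y z by (auto simp: inj_on_def atMost_Suc)
  moreover have "\<forall>i\<le>Suc n. (y(Suc n := z)) i \<in> W i"
    using y z by (auto simp: le_Suc_eq)
  ultimately show ?case by blast
qed

lemma funpow_semiconj:
  assumes "\<And>x. x \<in> X \<Longrightarrow> g x \<in> X" "\<And>x. x \<in> X \<Longrightarrow> h (g x) = f (h x)" "x \<in> X"
  shows "h ((g ^^ n) x) = (f ^^ n) (h x) \<and> (g ^^ n) x \<in> X"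
  by (induction n) (use assms in auto)

text \<open>Compactness bounds the distances, which makes the supremum in \<open>dC0\<close> a
  genuine upper bound.\<close>

lemma dC0_less_imp_dist_less:
  assumes "compact X" "continuous_on X f" "continuous_on X g" "dC0 X f g < e" "x \<in> X"
  shows "dist (f x) (g x) < e"
proof -
  have "compact ((\<lambda>x. dist (f x) (g x)) ` X)"
    using assms by (intro compact_continuous_image continuous_intros)
  then have "bdd_above ((\<lambda>x. dist (f x) (g x)) ` X)"
    by (intro bounded_imp_bdd_above compact_imp_bounded)
  then have "dist (f x) (g x) \<le> dC0 X f g"
    unfolding dC0_def using assms(5) by (rule cSUP_upper2) auto
  then show ?thesis using assms(4) by simp
qed

lemma homeos_funpow_continuous_on:
  assumes "f \<in> homeos X"
  shows "continuous_on X (f ^^ n) \<and> (f ^^ n) ` X \<subseteq> X"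
proof (induction n)
  case 0
  then show ?case by (simp add: continuous_on_id)
next
  case (Suc n)
  then have "continuous_on X (f \<circ> f ^^ n)"
    using homeos_continuous_on[OF assms] by (metis continuous_on_compose continuous_on_subset)
  then show ?case using Suc homeos_mem[OF assms] by (auto simp: o_def)
qed

theorem strongly_topologically_stable_imp_shadowing:
  fixes X :: "'a::metric_space set"
  assumes X: "cantor_space X" and f: "f \<in> homeos X" and st: "strongly_topologically_stable X f"
  shows "shadowing X f"
proof (cases "X = {}")
  case True
  then show ?thesis unfolding shadowing_def by (auto intro: exI[of _ 1])
next
  case False
  have cX: "compact X" using X cantor_space_compact by blast
  show ?thesis
    unfolding shadowing_def
  proof (intro allI impI)
    fix e :: real assume e: "e > 0"
    have "\<forall>e>0. \<exists>\<delta>>0. \<forall>g\<in>homeos X. Dhom X f g < \<delta> \<longrightarrow>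
        (\<exists>h. continuous_on X h \<and> h ` X = X \<and> dC0 X h id < e \<and> (\<forall>x\<in>X. h (g x) = f (h x)))"
      using st by (simp only: strongly_topologically_stable_def)
    then obtain \<delta> where \<delta>: "\<delta> > 0" "\<forall>g\<in>homeos X. Dhom X f g < \<delta> \<longrightarrow>
        (\<exists>h. continuous_on X h \<and> h ` X = X \<and> dC0 X h id < e/2 \<and> (\<forall>x\<in>X. h (g x) = f (h x)))"
      using half_gt_zero[OF e] by blast
    obtain \<P> where P: "clopen_partition X \<P>"
      "\<forall>g\<in>homeos X. (\<forall>x\<in>X. cell \<P> (g x) = cell \<P> (f x)) \<longrightarrow> Dhom X f g < \<delta>"
      using Dhom_less_if_same_cells[OF X False f \<delta>(1)] by blast
    obtain d where d: "d > 0" "\<And>x y. x \<in> X \<Longrightarrow> y \<in> X \<Longrightarrow> dist x y \<le> d \<Longrightarrow> cell \<P> x = cell \<P> y"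
      using clopen_partition_gap[OF cX P(1)] by blast
    have shadow: "\<exists>x\<in>X. \<forall>i. dist (xs i) ((f ^^ i) x) \<le> e"
      if xs: "\<And>i. xs i \<in> X" "\<And>i. dist (f (xs i)) (xs (Suc i)) \<le> d" for xs :: "nat \<Rightarrow> 'a"
    proof -
      \<comment> \<open>\<open>Z N\<close> consists of the points whose \<open>f\<close>-orbit
        shadows up to time \<open>N\<close>; these sets are compact and decreasing, so finite
        shadowing suffices.\<close>
      define Z where "Z N = (\<Inter>i\<in>{..N}. {z\<in>X. (f ^^ i) z \<in> cball (xs i) e})" for N
      \<comment> \<open>The admissible replacements of \<open>xs i\<close>: close to it, in its
        cell, and with image in the cell of \<open>f (xs i)\<close>. They are infinitely many, which
        makes a choice of distinct points possible.\<close>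
      define W where "W i = X \<inter> ball (xs i) (e/2) \<inter> cell \<P> (xs i) \<inter> {y\<in>X. f y \<in> cell \<P> (f (xs i))}" for i
      have inf: "infinite (W i)" for i
      proof (rule cantor_space_openin_infinite[OF X])
        have "xs i \<in> W i"
          using xs(1)[of i] e cell_mem[OF P(1) xs(1)[of i]] cell_mem[OF P(1) homeos_mem[OF f xs(1)[of i]]]
          by (simp add: W_def)
        then show "W i \<noteq> {}" by auto
        have "clopenin X (cell \<P> (xs i))" "clopenin X (cell \<P> (f (xs i)))"
          using P(1) cell_mem[OF P(1) xs(1)[of i]] cell_mem[OF P(1) homeos_mem[OF f xs(1)[of i]]]
          unfolding clopen_partition_def by simp_all
        then have "openin (top_of_set X) (cell \<P> (xs i))"
            "openin (top_of_set X) {y\<in>X. f y \<in> cell \<P> (f (xs i))}"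
          using clopenin_vimage[OF homeos_continuous_on[OF f], of X] homeos_image[OF f]
          by (simp_all add: clopenin_def)
        moreover have "openin (top_of_set X) (X \<inter> ball (xs i) (e/2))"
          by (simp add: openin_open_Int)
        ultimately show "openin (top_of_set X) (W i)" unfolding W_def by (blast intro: openin_Int)
      qed
      have "Z N \<noteq> {}" for N
      proof -
        obtain y where y: "inj_on y {..N}" "\<forall>i\<le>N. y i \<in> W i"
          using distinct_choice_infinite_sets[of W N] inf by blast
        have yX: "y i \<in> X" "cell \<P> (y i) = cell \<P> (xs i)" "cell \<P> (f (y i)) = cell \<P> (f (xs i))"
           "dist (xs i) (y i) < e/2" if "i \<le> N" for i
        proof -
          have W: "y i \<in> X" "dist (xs i) (y i) < e/2" "y i \<in> cell \<P> (xs i)" "f (y i) \<in> cell \<P> (f (xs i))"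
            using y(2) that by (simp_all add: W_def)
          have "cell \<P> (xs i) \<in> \<P>" "cell \<P> (f (xs i)) \<in> \<P>"
            using cell_mem[OF P(1) xs(1)[of i]] cell_mem[OF P(1) homeos_mem[OF f xs(1)[of i]]] by simp_all
          then show "y i \<in> X" "cell \<P> (y i) = cell \<P> (xs i)" "cell \<P> (f (y i)) = cell \<P> (f (xs i))"
             "dist (xs i) (y i) < e/2"
            using W cell_eq[OF P(1) _ W(3)] cell_eq[OF P(1) _ W(4)] by blast+
        qed
        \<comment> \<open>\<open>f (y i)\<close> shares its cell with \<open>f (xs i)\<close>, hence
          by the choice of \<open>d\<close> with \<open>xs (Suc i)\<close>, hence with
          \<open>y (Suc i)\<close>. So a cell-preserving \<open>k\<close> can close every gap of the
          pseudo-orbit.\<close>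
        have "\<exists>k\<in>homeos X. (\<forall>x\<in>X. cell \<P> (k x) = cell \<P> x) \<and> (\<forall>i<N. k (f (y i)) = y (Suc i))"
        proof (rule homeos_move_points_in_cells[OF X P(1)])
          show "inj_on (\<lambda>i. f (y i)) {..<N}" 
          proof (rule inj_onI)
            fix i j assume ij: "i \<in> {..<N}" "j \<in> {..<N}" "f (y i) = f (y j)"
            then have "y i = y j" using inj_onD[OF homeos_inj_on[OF f] ij(3)] yX(1) by simp
            then show "i = j" using inj_onD[OF y(1)] ij by simp
          qed
          show "inj_on (\<lambda>i. y (Suc i)) {..<N}"
          proof (rule inj_onI)
            fix i j assume "i \<in> {..<N}" "j \<in> {..<N}" "y (Suc i) = y (Suc j)"
            then show "i = j" using inj_onD[OF y(1), of "Suc i" "Suc j"] by simp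
          qed
          show "f (y i) \<in> X" "y (Suc i) \<in> X" if "i < N" for i
            using that yX(1) homeos_mem[OF f yX(1)[of i]] by simp_all
          show "cell \<P> (f (y i)) = cell \<P> (y (Suc i))" if "i < N" for i
            using that yX(2)[of "Suc i"] yX(3)[of i] d(2)[OF homeos_mem[OF f xs(1)] xs(1) xs(2), of i] by simp
        qed
        then obtain k where k: "k \<in> homeos X" "\<And>x. x \<in> X \<Longrightarrow> cell \<P> (k x) = cell \<P> x"
            "\<And>i. i < N \<Longrightarrow> k (f (y i)) = y (Suc i)" by blast
        define g where "g = k \<circ> f"
        have g: "g \<in> homeos X" using homeos_comp[OF f k(1)] by (simp add: g_def)
        have "Dhom X f g < \<delta>" using P(2) g k(2) homeos_mem[OF f] by (simp add: g_def)
        then obtain h where h: "continuous_on X h" "h ` X = X" "dC0 X h id < e/2" "\<And>x. x \<in> X \<Longrightarrow> h (g x) = f (h x)"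
          using \<delta>(2) g by blast
        have orb: "(g ^^ i) (y 0) = y i" if "i \<le> N" for i
          using that by (induction i) (simp_all add: g_def k(3))
        have "h (y 0) \<in> Z N"
        proof -
          have "dist (xs i) ((f ^^ i) (h (y 0))) \<le> e" if i: "i \<le> N" for i
          proof -
            have "h ((g ^^ i) (y 0)) = (f ^^ i) (h (y 0))"
              using funpow_semiconj[of X g h f "y 0" i] homeos_mem[OF g] h(4) yX(1)[of 0] by simp
            then have "h (y i) = (f ^^ i) (h (y 0))" using orb[OF i] by simp
            moreover have "dist (h (y i)) (id (y i)) < e/2"
              using dC0_less_imp_dist_less[OF cX h(1) continuous_on_id' h(3)] yX(1)[OF i] by simp
            ultimately show ?thesis
              using yX(4)[OF i] dist_triangle_half_r[of "y i" "xs i" e "h (y i)"] by (simp add: dist_commute)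
          qed
          moreover have "h (y 0) \<in> X" using h(2) yX(1)[of 0] by auto
          ultimately show ?thesis by (auto simp: Z_def)
        qed
        then show ?thesis by auto
      qed
      moreover have "compact (Z N)" for N
      proof -
        have "closedin (top_of_set X) (X \<inter> (f ^^ i) -` cball (xs i) e)" for i
          using homeos_funpow_continuous_on[OF f] by (intro continuous_closedin_preimage) auto
        moreover have "X \<inter> (f ^^ i) -` cball (xs i) e = {z\<in>X. (f ^^ i) z \<in> cball (xs i) e}" for i by auto
        ultimately have "closedin (top_of_set X) (Z N)"
          unfolding Z_def by (intro closedin_Inter) auto
        then show ?thesis using closedin_compact cX by blast
      qed
      moreover have "Z (Suc N) \<subseteq> Z N" for N by (auto simp: Z_def)
      ultimately have "(\<Inter>N. Z N) \<noteq> {}" by (intro compact_nested_Inter_nonempty)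
      then obtain z where z: "\<And>N. z \<in> Z N" by auto
      then have "z \<in> X" "\<And>i. dist (xs i) ((f ^^ i) z) \<le> e" by (auto simp: Z_def)
      then show ?thesis by blast
    qed
    show "\<exists>\<delta>>0. \<forall>xs. (\<forall>i. xs i \<in> X) \<and> (\<forall>i. dist (f (xs i)) (xs (Suc i)) \<le> \<delta>) \<longrightarrow>
         (\<exists>x\<in>X. \<forall>i. dist (xs i) ((f ^^ i) x) \<le> e)"
      using d(1) shadow by (intro exI[of _ d]) simp
  qed
qed

section \<open>Finite sets meeting every closed invariant set\<close>

text \<open>For continuous \<open>g\<close> on compact \<open>X\<close> this says that
  \<open>F\<close> contains all minimal sets. The formulation by closed invariant sets is the one
  that pulls back along semiconjugacies.\<close>

definition captures :: "'a::topological_space set \<Rightarrow> ('a \<Rightarrow> 'a) \<Rightarrow> 'a set \<Rightarrow> bool" where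
  "captures X g F \<longleftrightarrow> finite F \<and> F \<subseteq> X \<and> g ` F \<subseteq> F \<and>
     (\<forall>K. closed K \<and> K \<subseteq> X \<and> K \<noteq> {} \<and> g ` K \<subseteq> K \<longrightarrow> K \<inter> F \<noteq> {})"

text \<open>The preimage under \<open>h\<close> of a closed set invariant under \<open>f\<close> is
  closed and invariant under \<open>g\<close>; surjectivity of \<open>h\<close> keeps it
  nonempty.\<close>

lemma captures_factor:
  fixes X :: "'a::t2_space set"
  assumes cX: "compact X" and F: "captures X g F" and g: "g ` X \<subseteq> X"
    and h: "continuous_on X h" "h ` X = X" "\<forall>x\<in>X. h (g x) = f (h x)"
  shows "captures X f (h ` F)"
  unfolding captures_def
proof (intro conjI allI impI)
  have F': "finite F" "F \<subseteq> X" "g ` F \<subseteq> F" using F by (auto simp: captures_def)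
  show "finite (h ` F)" "h ` F \<subseteq> X" using F' h by auto
  show "f ` h ` F \<subseteq> h ` F"
  proof clarify
    fix x assume x: "x \<in> F"
    then have "f (h x) = h (g x)" using F' h(3) by auto
    then show "f (h x) \<in> h ` F" using F' x by blast
  qed
  fix K assume K: "closed K \<and> K \<subseteq> X \<and> K \<noteq> {} \<and> f ` K \<subseteq> K"
  define L where "L = X \<inter> h -` K"
  have "closedin (top_of_set X) L"
    unfolding L_def using h(1) K by (intro continuous_closedin_preimage) auto
  then have "closed L" using cX closedin_compact compact_imp_closed by blast
  moreover have "L \<subseteq> X" by (auto simp: L_def)
  moreover have "L \<noteq> {}"
  proof -
    obtain y where "y \<in> K" using K by blast
    then have "y \<in> h ` X" unfolding h(2) using K by blast
    then obtain x where "x \<in> X" "h x = y" by blast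
    then show ?thesis using \<open>y \<in> K\<close> by (auto simp: L_def)
  qed
  moreover have "g ` L \<subseteq> L"
    using g h(3) K by (auto simp: L_def)
  ultimately have "L \<inter> F \<noteq> {}" using F unfolding captures_def by blast
  then show "K \<inter> h ` F \<noteq> {}" by (auto simp: L_def)
qed

lemma funpow_image_subset: "f ` K \<subseteq> K \<Longrightarrow> (f ^^ n) ` K \<subseteq> K"
  by (induction n) auto

text \<open>The orbit shadowing a periodic pseudo-orbit need not be periodic, but its times
  divisible by the period stay near \<open>x\<close>. Their closure generates a closed invariant
  set, and a point of \<open>F\<close> in that set is carried by finitely many steps back near
  \<open>x\<close>, where \<open>F\<close> has no points.\<close>

theorem nonwandering_subset_if_captures:
  fixes X :: "'a::metric_space set"
  assumes cX: "compact X" and f: "f \<in> homeos X" and sh: "shadowing X f" and F: "captures X f F"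
  shows "nonwandering X f \<subseteq> F"
proof (rule subsetI, rule ccontr)
  fix x assume x: "x \<in> nonwandering X f" and xF: "x \<notin> F"
  have F': "finite F" "F \<subseteq> X" "f ` F \<subseteq> F" using F by (auto simp: captures_def)
  obtain r where r: "r > 0" "\<And>y. y \<in> F \<Longrightarrow> r \<le> dist x y"
    using finite_set_avoid[OF F'(1), of x] xF by metis
  \<comment> \<open>The shadowing orbit returns within \<open>2 * e\<close> of \<open>x\<close>, one
    \<open>e\<close> for shadowing and one for \<open>y\<close>; this has to stay below the distance
    \<open>r\<close> to \<open>F\<close>.\<close>
  define e where "e = r/4"
  have e: "e > 0" using r by (simp add: e_def)
  obtain d where d: "d > 0" and shd: "\<And>xs. (\<forall>i. xs i \<in> X) \<Longrightarrow> (\<forall>i. dist (f (xs i)) (xs (Suc i)) \<le> d) \<Longrightarrow>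
        (\<exists>x\<in>X. \<forall>i. dist (xs i) ((f ^^ i) x) \<le> e)"
  proof -
    have "\<exists>\<delta>>0. \<forall>xs::nat \<Rightarrow> 'a. (\<forall>i. xs i \<in> X) \<and> (\<forall>i. dist (f (xs i)) (xs (Suc i)) \<le> \<delta>) \<longrightarrow>
        (\<exists>x\<in>X. \<forall>i. dist (xs i) ((f ^^ i) x) \<le> e)"
      using sh e unfolding shadowing_def by simp
    then obtain \<delta> where *: "\<delta> > 0" "\<forall>xs::nat \<Rightarrow> 'a. (\<forall>i. xs i \<in> X) \<and> (\<forall>i. dist (f (xs i)) (xs (Suc i)) \<le> \<delta>) \<longrightarrow>
        (\<exists>x\<in>X. \<forall>i. dist (xs i) ((f ^^ i) x) \<le> e)" by (elim exE conjE)
    show thesis by (rule that[OF *(1)]) (use *(2) in simp)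
  qed
  \<comment> \<open>The only jump of the periodic pseudo-orbit joins two points of the
    \<open>m\<close>-ball around \<open>x\<close>, so it is at most \<open>2 * m\<close>, hence at
    most \<open>d\<close>.\<close>
  define m where "m = min e (d/2)"
  have m: "m > 0" "m \<le> e" "2 * m \<le> d" using e d by (auto simp: m_def)
  have xX: "x \<in> X" using x by (simp add: nonwandering_def)
  have "openin (top_of_set X) (X \<inter> ball x m)" "x \<in> X \<inter> ball x m"
    using m xX by (auto simp: openin_open_Int)
  then have "\<exists>n>0. (f ^^ n) ` (X \<inter> ball x m) \<inter> (X \<inter> ball x m) \<noteq> {}"
    using x unfolding nonwandering_def by blast
  then obtain n y where n: "n > 0" and y: "y \<in> X" "dist x y < m" "(f ^^ n) y \<in> X" "dist x ((f ^^ n) y) < m"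
    by auto
  have fX: "(f ^^ i) w \<in> X" if "w \<in> X" for i w
    using homeos_funpow_continuous_on[OF f, of i] that by auto
  define xs where "xs i = (f ^^ (i mod n)) y" for i
  have "\<exists>z\<in>X. \<forall>i. dist (xs i) ((f ^^ i) z) \<le> e"
  proof (rule shd)
    show "\<forall>i. xs i \<in> X" using fX y by (simp add: xs_def)
    show "\<forall>i. dist (f (xs i)) (xs (Suc i)) \<le> d"
    proof
      fix i
      show "dist (f (xs i)) (xs (Suc i)) \<le> d"
      proof (cases "Suc (i mod n) = n")
        case True
        then have "f (xs i) = (f ^^ n) y" "xs (Suc i) = y"
          by (auto simp: xs_def mod_Suc simp flip: funpow.simps(2) comp_apply[of f])
        then have "dist (f (xs i)) (xs (Suc i)) \<le> dist x ((f ^^ n) y) + dist x y"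
          by (metis dist_triangle3)
        then show ?thesis using y m by linarith
      next
        case False
        then have "xs (Suc i) = f (xs i)" by (simp add: xs_def mod_Suc)
        then show ?thesis using d by simp
      qed
    qed
  qed
  then obtain z where z: "z \<in> X" "\<And>i. dist (xs i) ((f ^^ i) z) \<le> e" by blast
  define L where "L = closure (range (\<lambda>k. (f ^^ (n * k)) z))"
  have "closed X" using cX compact_imp_closed by blast
  then have LX: "L \<subseteq> X" unfolding L_def
    by (intro closure_minimal) (use fX z(1) in auto)
  have "L \<subseteq> cball x (2 * e)"
    unfolding L_def
  proof (rule closure_minimal)
    have "dist x ((f ^^ (n * k)) z) \<le> 2 * e" for k
    proof -
      have "dist y ((f ^^ (n * k)) z) \<le> e" using z(2)[of "n * k"] by (simp add: xs_def)
      then show ?thesis using y(2) m(2) dist_triangle[of x "(f ^^ (n * k)) z" y] by linarith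
    qed
    then show "range (\<lambda>k. (f ^^ (n * k)) z) \<subseteq> cball x (2 * e)" by auto
  qed auto
  then have Lball: "dist x l \<le> 2 * e" if "l \<in> L" for l using that by auto
  have fn: "(f ^^ n) ` L \<subseteq> L"
    unfolding L_def
  proof (rule image_closure_subset)
    show "continuous_on (closure (range (\<lambda>k. (f ^^ (n * k)) z))) (f ^^ n)"
      using homeos_funpow_continuous_on[OF f] LX continuous_on_subset unfolding L_def by blast
    have "(f ^^ n) ((f ^^ (n * k)) z) = (f ^^ (n * Suc k)) z" for k
      by (simp add: funpow_add)
    then have "(f ^^ n) ` range (\<lambda>k. (f ^^ (n * k)) z) \<subseteq> range (\<lambda>k. (f ^^ (n * k)) z)"
      by (auto simp del: mult_Suc_right)
    then show "(f ^^ n) ` range (\<lambda>k. (f ^^ (n * k)) z) \<subseteq> closure (range (\<lambda>k. (f ^^ (n * k)) z))"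
      by (rule order_trans[OF _ closure_subset])
  qed auto
  have cL: "compact L" 
    using compact_Int_closed[OF cX, of L] LX by (simp add: L_def Int_absorb1)
  \<comment> \<open>\<open>L\<close> is invariant only under \<open>f ^^ n\<close>; the first
    \<open>n\<close> images together are invariant under \<open>f\<close>.\<close>
  define K where "K = (\<Union>i\<in>{..<n}. (f ^^ i) ` L)"
  have "compact ((f ^^ i) ` L)" for i
    using homeos_funpow_continuous_on[OF f, of i] LX cL
    by (intro compact_continuous_image) (auto intro: continuous_on_subset)
  then have "compact K" unfolding K_def by (intro compact_UN) auto
  then have "closed K" by (rule compact_imp_closed)
  moreover have "K \<subseteq> X" using LX fX by (auto simp: K_def)
  moreover have "K \<noteq> {}"
  proof -
    have "z \<in> L" unfolding L_def using closure_subset[of "range (\<lambda>k. (f ^^ (n * k)) z)"]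
      by (auto intro!: rev_image_eqI[of 0])
    then show ?thesis using n by (auto simp: K_def)
  qed
  moreover have "f ` K \<subseteq> K"
  proof clarify
    fix w assume "w \<in> K"
    then obtain i l where i: "i < n" "l \<in> L" "w = (f ^^ i) l" by (auto simp: K_def)
    show "f w \<in> K"
    proof (cases "Suc i = n")
      case True
      then have "f w = (f ^^ n) l" using i by auto
      then have "f w \<in> L" using fn i by auto
      then show ?thesis using n by (auto simp: K_def intro!: bexI[of _ 0])
    next
      case False
      then have "Suc i < n" "f w = (f ^^ Suc i) l" using i by auto
      then show ?thesis using i unfolding K_def by blast
    qed
  qed
  ultimately have "K \<inter> F \<noteq> {}" using F unfolding captures_def by blast
  then obtain i l where i: "i < n" "l \<in> L" "(f ^^ i) l \<in> F" by (auto simp: K_def)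
  \<comment> \<open>The point of \<open>F\<close> may sit in any of the \<open>n\<close> images,
    possibly far from \<open>x\<close>. Completing the period keeps it in \<open>F\<close> and
    returns it to \<open>L\<close>.\<close>
  have "(f ^^ n) l = (f ^^ (n - i)) ((f ^^ i) l)"
    using i(1) funpow_add[of "n - i" i f] by simp
  then have "(f ^^ n) l \<in> F"
    using funpow_image_subset[OF F'(3), of "n - i"] i by auto
  moreover have "(f ^^ n) l \<in> L" using fn i by auto
  ultimately have "r \<le> 2 * e" using r(2)[of "(f ^^ n) l"] Lball[of "(f ^^ n) l"] by simp
  then show False using r by (simp add: e_def)
qed

section \<open>Contracting self-embeddings and return maps\<close>

lemma contracting_self_embedding:
  fixes U :: "'a::metric_space set"
  assumes U: "cantor_space U" and ne: "U \<noteq> {}"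
  shows "\<exists>c u. continuous_on U c \<and> inj_on c U \<and> clopenin U (c ` U) \<and> c ` U \<noteq> U \<and> u \<in> U \<and> c u = u \<and>
     (\<forall>K. closed K \<and> K \<subseteq> U \<and> K \<noteq> {} \<and> c ` K \<subseteq> K \<longrightarrow> u \<in> K)"
proof -
  obtain p where "p \<in> U" using ne by blast
  then obtain \<phi> \<psi> where hom: "homeomorphism U bitseqs \<phi> \<psi>"
    using cantor_space_homeomorphism_bitseqs[OF U] by metis
  have \<phi>: "continuous_on U \<phi>" "\<And>x. x \<in> U \<Longrightarrow> \<phi> x \<in> bitseqs" "\<And>x. x \<in> U \<Longrightarrow> \<psi> (\<phi> x) = x"
    and \<psi>: "continuous_on bitseqs \<psi>" "\<And>s. s \<in> bitseqs \<Longrightarrow> \<psi> s \<in> U" "\<And>s. s \<in> bitseqs \<Longrightarrow> \<phi> (\<psi> s) = s"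
    using hom by (auto simp: homeomorphism_def)
  \<comment> \<open>In the bit sequence model the contraction prepends the bit 1.\<close>
  define w :: "(nat \<Rightarrow> real) \<Rightarrow> nat \<Rightarrow> real" where "w s n = (case n of 0 \<Rightarrow> 1 | Suc m \<Rightarrow> s m)" for s n
  have w: "w s 0 = 1" "w s (Suc m) = s m" for s m by (simp_all add: w_def)
  have wb: "w s \<in> bitseqs" if "s \<in> bitseqs" for s
    using that by (auto simp: bitseqs_def w_def split: nat.split)
  have one: "(\<lambda>_. 1) \<in> bitseqs" "(\<lambda>_. 0) \<in> bitseqs" by (auto simp: bitseqs_def)
  have wcont: "continuous_on bitseqs w"
  proof (rule continuous_on_coordinatewise_then_product)
    fix i
    show "continuous_on bitseqs (\<lambda>s. w s i)"
      by (cases i) (auto simp: w intro!: continuous_on_product_then_coordinatewise continuous_on_id)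
  qed
  define c where "c = \<psi> \<circ> w \<circ> \<phi>"
  define u where "u = \<psi> (\<lambda>_. 1)"
  have \<phi>c: "\<phi> (c x) = w (\<phi> x)" if "x \<in> U" for x
    using \<psi>(3)[OF wb[OF \<phi>(2)[OF that]]] by (simp add: c_def)
  have cU: "c x \<in> U" if "x \<in> U" for x
    using \<psi>(2)[OF wb[OF \<phi>(2)[OF that]]] by (simp add: c_def)
  have \<phi>inj: "x = y" if "x \<in> U" "y \<in> U" "\<phi> x = \<phi> y" for x y
    using \<phi>(3)[OF that(1)] \<phi>(3)[OF that(2)] that(3) by metis
  have "continuous_on U c"
    unfolding c_def
  proof (rule continuous_on_compose[OF \<phi>(1) continuous_on_compose])
    show "continuous_on (\<phi> ` U) w"
      using \<phi>(2) by (intro continuous_on_subset[OF wcont] image_subsetI)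
    show "continuous_on (w ` \<phi> ` U) \<psi>"
      using \<phi>(2) wb by (intro continuous_on_subset[OF \<psi>(1)] image_subsetI) blast
  qed
  moreover have "inj_on c U"
  proof (rule inj_onI)
    fix x y assume xy: "x \<in> U" "y \<in> U" "c x = c y"
    then have "w (\<phi> x) = w (\<phi> y)" using \<phi>c[of x] \<phi>c[of y] by simp
    then have "\<phi> x m = \<phi> y m" for m using w(2)[of "\<phi> x" m] w(2)[of "\<phi> y" m] by simp
    then show "x = y" using \<phi>inj xy by blast
  qed
  moreover have img: "c ` U = {x\<in>U. \<phi> x 0 = 1}"
  proof
    show "c ` U \<subseteq> {x\<in>U. \<phi> x 0 = 1}" using cU \<phi>c w(1) by (intro image_subsetI) simp
    show "{x\<in>U. \<phi> x 0 = 1} \<subseteq> c ` U"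
    proof clarify
      fix x assume x: "x \<in> U" "\<phi> x 0 = 1"
      define s where "s m = \<phi> x (Suc m)" for m
      have s: "s \<in> bitseqs" using \<phi>(2)[OF x(1)] by (auto simp: s_def bitseqs_def)
      have "w s n = \<phi> x n" for n using x(2) by (cases n) (simp_all add: w_def s_def)
      then have ws: "w s = \<phi> x" by (rule ext)
      have "c (\<psi> s) = x" using \<psi>(3)[OF s] ws \<phi>(3)[OF x(1)] by (simp add: c_def)
      then show "x \<in> c ` U" using \<psi>(2)[OF s] by (metis imageI)
    qed
  qed
  have coord: "continuous_on U (\<lambda>x. \<phi> x i)" for i
    by (rule continuous_on_product_then_coordinatewise[OF \<phi>(1)])
  have \<phi>2: "\<phi> x 0 = 1 \<longleftrightarrow> \<phi> x 0 > 0" if "x \<in> U" for x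
    using \<phi>(2)[OF that] by (auto simp: bitseqs_def dest: spec[of _ 0])
  have "clopenin U (c ` U)"
    unfolding clopenin_def
  proof
    have "c ` U = U \<inter> (\<lambda>x. \<phi> x 0) -` {1}" using img by auto
    then show "closedin (top_of_set U) (c ` U)" using coord by (simp add: continuous_closedin_preimage)
    have "c ` U = U \<inter> (\<lambda>x. \<phi> x 0) -` {0<..}" using img \<phi>2 by auto
    then show "openin (top_of_set U) (c ` U)" using coord by (simp add: continuous_openin_preimage_gen)
  qed
  \<comment> \<open>The sequence of zeros does not begin with 1. Properness is needed later to have
    nonempty complements to match.\<close>
  moreover have "c ` U \<noteq> U"
  proof
    assume "c ` U = U"
    then have "\<psi> (\<lambda>_. 0) \<in> c ` U" using \<psi>(2)[OF one(2)] by simp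
    then show False using \<psi>(3)[OF one(2)] by (simp add: img)
  qed
  moreover have "u \<in> U" using \<psi>(2) one by (simp add: u_def)
  moreover have "c u = u"
  proof -
    have "w (\<lambda>_. 1) n = 1" for n by (cases n) (simp_all add: w_def)
    then have "w (\<lambda>_. 1) = (\<lambda>_. 1)" by (rule ext)
    then show ?thesis using \<psi>(3)[OF one(1)] by (simp add: c_def u_def)
  qed
  \<comment> \<open>Each application of \<open>c\<close> lengthens the initial run of ones, so
    \<open>K\<close> contains points with arbitrarily long runs, and by compactness the all-ones
    point \<open>u\<close>.\<close>
  moreover have "u \<in> K" if K: "closed K" "K \<subseteq> U" "K \<noteq> {}" "c ` K \<subseteq> K" for K
  proof -
    have cK: "compact K" using compact_Int_closed[OF cantor_space_compact[OF U] K(1)] K(2) by (simp add: Int_absorb1)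
    define L where "L n = {y\<in>K. \<forall>m<n. \<phi> y m = 1}" for n
    have "L n \<noteq> {}" for n
    proof -
      obtain x where "x \<in> K" using K by blast
      then have "(c ^^ n) x \<in> K \<and> (\<forall>m<n. \<phi> ((c ^^ n) x) m = 1)"
      proof (induction n)
        case (Suc n)
        then have IH: "(c ^^ n) x \<in> K" "\<And>m. m < n \<Longrightarrow> \<phi> ((c ^^ n) x) m = 1" by auto
        have "\<phi> ((c ^^ Suc n) x) m = 1" if "m < Suc n" for m
          using \<phi>c[of "(c ^^ n) x"] IH K(2) that by (cases m) (auto simp: w)
        then show ?case using IH K(4) by auto
      qed auto
      then show ?thesis by (auto simp: L_def)
    qed
    moreover have "compact (L n)" for n
    proof -
      have "closedin (top_of_set K) (K \<inter> (\<lambda>y. \<phi> y m) -` {1})" for m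
        using coord K(2) by (intro continuous_closedin_preimage) (auto intro: continuous_on_subset)
      moreover have "L 0 = K" "L (Suc n) = L n \<inter> (K \<inter> (\<lambda>y. \<phi> y n) -` {1})" for n
        by (auto simp: L_def less_Suc_eq)
      ultimately have "closedin (top_of_set K) (L n)"
        by (induction n) (simp_all add: closedin_Int)
      then show ?thesis using cK closedin_compact by blast
    qed
    moreover have "L (Suc n) \<subseteq> L n" for n by (auto simp: L_def)
    ultimately have "(\<Inter>n. L n) \<noteq> {}" by (intro compact_nested_Inter_nonempty)
    then obtain y where y: "\<And>n. y \<in> L n" by auto
    have yK: "y \<in> K" using y[of 0] by (simp add: L_def)
    have "\<phi> y m = 1" for m using y[of "Suc m"] by (simp add: L_def)
    then have "\<phi> y = (\<lambda>_. 1)" by (rule ext)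
    then have "y = u" using \<phi>(3)[of y] yK K(2) by (auto simp: u_def)
    then show ?thesis using yK by simp
  qed
  ultimately show ?thesis by (intro exI[of _ c] exI[of _ u]) simp
qed

text \<open>Let \<open>c\<close> be a contracting embedding. Carrying \<open>e x\<close> to
  \<open>c x\<close> is a homeomorphism between two proper clopen subsets; their complements are
  homeomorphic too, so it extends to \<open>\<theta>\<close>, and \<open>\<theta> \<circ> e\<close>
  agrees with \<open>c\<close> on \<open>U\<close>.\<close>

lemma homeos_making_embedding_contract:
  fixes U :: "'a::metric_space set"
  assumes U: "cantor_space U" "U \<noteq> {}"
    and e: "continuous_on U e" "inj_on e U" "clopenin U (e ` U)" "e ` U \<noteq> U"
  shows "\<exists>\<theta>\<in>homeos U. \<exists>u\<in>U. \<theta> (e u) = u \<and>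
     (\<forall>K. closed K \<and> K \<subseteq> U \<and> K \<noteq> {} \<and> (\<theta> \<circ> e) ` K \<subseteq> K \<longrightarrow> u \<in> K)"
proof -
  have cU: "compact U" using U cantor_space_compact by blast
  obtain c u where c: "continuous_on U c" "inj_on c U" "clopenin U (c ` U)" "c ` U \<noteq> U" "u \<in> U" "c u = u"
     "\<forall>K. closed K \<and> K \<subseteq> U \<and> K \<noteq> {} \<and> c ` K \<subseteq> K \<longrightarrow> u \<in> K"
    using contracting_self_embedding[OF U] by blast
  obtain e' where e': "homeomorphism U (e ` U) e e'"
    using homeomorphism_compact[OF cU e(1) refl e(2)] by blast
  obtain c' where c': "homeomorphism U (c ` U) c c'"
    using homeomorphism_compact[OF cU c(1) refl c(2)] by blast
  have h1: "homeomorphism (e ` U) (c ` U) (c \<circ> e') (e \<circ> c')"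
    using homeomorphism_compose[OF homeomorphism_symD[OF e'] c'] .
  have sub: "e ` U \<subseteq> U" "c ` U \<subseteq> U" using e(3) c(3) clopenin_subset by auto
  have cl: "clopenin U (U - e ` U)" "clopenin U (U - c ` U)" using e(3) c(3) by (auto intro: clopenin_Diff)
  obtain p q where pq: "p \<in> U - e ` U" "q \<in> U - c ` U" using sub e(4) c(4) by blast
  obtain \<phi> \<psi> where h2: "homeomorphism (U - e ` U) (U - c ` U) \<phi> \<psi>"
    using cantor_spaces_pointed_homeomorphism[OF cantor_space_clopenin[OF U(1) cl(1)] pq(1) cantor_space_clopenin[OF U(1) cl(2)] pq(2)]
    by metis
  have "\<exists>\<theta>\<in>homeos U. \<forall>i\<in>UNIV. \<forall>x\<in>(if i then e ` U else U - e ` U). \<theta> x = (if i then c \<circ> e' else \<phi>) x"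
  proof (rule homeos_glue[OF cU, where B = "\<lambda>i. if i then c ` U else U - c ` U" and \<psi> = "\<lambda>i. if i then e \<circ> c' else \<psi>"])
    show "compact (if i then e ` U else U - e ` U)" for i
      using clopenin_compact[OF cU e(3)] clopenin_compact[OF cU cl(1)] by simp
    show "homeomorphism (if i then e ` U else U - e ` U) (if i then c ` U else U - c ` U)
         (if i then c \<circ> e' else \<phi>) (if i then e \<circ> c' else \<psi>)" for i
      using h1 h2 by simp
  qed (use sub in \<open>auto simp: disjoint_family_on_def UNIV_bool split: if_splits\<close>)
  then obtain \<theta> where \<theta>: "\<theta> \<in> homeos U" "\<forall>i. \<forall>x\<in>(if i then e ` U else U - e ` U). \<theta> x = (if i then c \<circ> e' else \<phi>) x"
    by blast
  have \<theta>e: "\<theta> (e x) = c x" if "x \<in> U" for x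
    using spec[OF \<theta>(2), of True] that e' by (simp add: homeomorphism_def)
  show ?thesis
  proof (intro bexI conjI allI impI)
    show "\<theta> \<in> homeos U" "u \<in> U" "\<theta> (e u) = u" using \<theta>(1) c(5,6) \<theta>e by auto
    fix K assume K: "closed K \<and> K \<subseteq> U \<and> K \<noteq> {} \<and> (\<theta> \<circ> e) ` K \<subseteq> K"
    have "c x \<in> K" if "x \<in> K" for x
    proof -
      have "(\<theta> \<circ> e) x \<in> K" using K that by blast
      moreover have "x \<in> U" using K that by blast
      ultimately show ?thesis using \<theta>e by simp
    qed
    then have "c ` K \<subseteq> K" by (rule image_subsetI)
    then show "u \<in> K" using c(7) K by simp
  qed
qed

text \<open>A set of minimal cardinality hit by all orbits has one point on each cycle, so each of its points is
  its own first return.\<close>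

lemma finite_return_set:
  fixes \<sigma> :: "'b \<Rightarrow> 'b"
  assumes "finite V" "\<sigma> ` V \<subseteq> V"
  shows "\<exists>R\<subseteq>V. (\<forall>v\<in>V. \<exists>n. (\<sigma> ^^ n) v \<in> R) \<and>
     (\<forall>r\<in>R. \<exists>p>0. (\<sigma> ^^ p) r = r \<and> (\<forall>i. 0 < i \<and> i < p \<longrightarrow> (\<sigma> ^^ i) r \<notin> R))"
proof -
  define P where "P R \<longleftrightarrow> R \<subseteq> V \<and> (\<forall>v\<in>V. \<exists>n. (\<sigma> ^^ n) v \<in> R)" for R
  have "P V" unfolding P_def by (auto intro: exI[of _ 0])
  then obtain R where R: "P R" "\<And>R'. P R' \<Longrightarrow> card R \<le> card R'"
    using ex_has_least_nat[of P V card] by blast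
  have RV: "R \<subseteq> V" "finite R" using R(1) assms(1) finite_subset by (auto simp: P_def)
  have "\<exists>p>0. (\<sigma> ^^ p) r = r \<and> (\<forall>i. 0 < i \<and> i < p \<longrightarrow> (\<sigma> ^^ i) r \<notin> R)" if r: "r \<in> R" for r
  proof -
    have "\<sigma> r \<in> V" using r RV assms(2) by blast
    then obtain n where "(\<sigma> ^^ n) (\<sigma> r) \<in> R" using R(1) unfolding P_def by blast
    then have ex: "0 < Suc n \<and> (\<sigma> ^^ Suc n) r \<in> R" by (simp add: funpow_swap1)
    define p where "p = (LEAST p. 0 < p \<and> (\<sigma> ^^ p) r \<in> R)"
    have p: "0 < p \<and> (\<sigma> ^^ p) r \<in> R"
      unfolding p_def by (rule LeastI[of "\<lambda>p. 0 < p \<and> (\<sigma> ^^ p) r \<in> R", OF ex])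
    have min: "(\<sigma> ^^ i) r \<notin> R" if "0 < i" "i < p" for i
      using not_less_Least[of i "\<lambda>p. 0 < p \<and> (\<sigma> ^^ p) r \<in> R"] that unfolding p_def by blast
    have "(\<sigma> ^^ p) r = r"
    proof (rule ccontr)
      assume ne: "(\<sigma> ^^ p) r \<noteq> r"
      have "P (R - {r})"
        unfolding P_def
      proof (intro conjI ballI)
        fix v assume "v \<in> V"
        then obtain n where n: "(\<sigma> ^^ n) v \<in> R" using R(1) unfolding P_def by blast
        show "\<exists>n. (\<sigma> ^^ n) v \<in> R - {r}"
        proof (cases "(\<sigma> ^^ n) v = r")
          case True
          then have "(\<sigma> ^^ (p + n)) v = (\<sigma> ^^ p) r" by (simp add: funpow_add)
          then show ?thesis using p ne by (intro exI[of _ "p + n"]) simp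
        qed (use n in blast)
      qed (use RV in auto)
      then have "card R \<le> card (R - {r})" using R(2) by blast
      moreover have "card (R - {r}) < card R" using RV r by (intro card_Diff1_less)
      ultimately show False by simp
    qed
    then show ?thesis using p min by blast
  qed
  then show ?thesis using R(1) RV unfolding P_def by blast
qed

lemma homeos_funpow: "f \<in> homeos X \<Longrightarrow> f ^^ n \<in> homeos X"
proof (induction n)
  case 0
  then show ?case using homeos_id by (simp add: id_def)
next
  case (Suc n)
  then show ?case using homeos_comp[of "f ^^ n" X f] by (simp only: funpow.simps)
qed

lemma homeos_clopenin_image:
  fixes X :: "'a::t2_space set"
  assumes cX: "compact X" and f: "f \<in> homeos X" and U: "clopenin X U"
  shows "clopenin X (f ` U)"
proof -
  have sub: "U \<subseteq> X" using clopenin_subset[OF U] .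
  obtain g where g: "homeomorphism X X f g" using f by (auto simp: homeos_def)
  have "f ` U = {y\<in>X. g y \<in> U}"
  proof
    show "f ` U \<subseteq> {y\<in>X. g y \<in> U}" using g sub by (auto simp: homeomorphism_def)
    show "{y\<in>X. g y \<in> U} \<subseteq> f ` U" using g unfolding homeomorphism_def by (auto intro!: image_eqI[of _ f])
  qed
  then show ?thesis
    using clopenin_vimage[of X g X U] g U by (simp add: homeomorphism_def)
qed

section \<open>Perturbation to a homeomorphism captured by a finite set\<close>

text \<open>It suffices to correct \<open>g\<close> on one piece \<open>S r\<close> per cycle of
  \<open>\<sigma>\<close>: the correction acts once per turn, so the new return map is the old one
  followed by a freely chosen homeomorphism of \<open>S r\<close>. \<open>\<sigma>\<close> need not
  be injective; pieces off the cycles just feed into them.\<close>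

lemma homeos_captures_cycles:
  fixes X :: "'a::metric_space set" and S :: "'b \<Rightarrow> 'a set"
  assumes X: "cantor_space X" and g: "g \<in> homeos X" and V: "finite V" "\<sigma> ` V \<subseteq> V"
    and S: "\<And>v. v \<in> V \<Longrightarrow> clopenin X (S v)" "\<And>v. v \<in> V \<Longrightarrow> S v \<noteq> {}" "disjoint_family_on S V"
    and gS: "\<And>v. v \<in> V \<Longrightarrow> g ` S v \<subset> S (\<sigma> v)"
  shows "\<exists>\<theta>\<in>homeos X. (\<forall>x\<in>X - (\<Union>v\<in>V. S v). \<theta> x = x) \<and> (\<forall>v\<in>V. \<theta> ` S v = S v) \<and>
     (\<exists>F. captures (\<Union>v\<in>V. S v) (\<theta> \<circ> g) F)"
proof -
  have cX: "compact X" using X cantor_space_compact by blast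
  have SX: "S v \<subseteq> X" if "v \<in> V" for v using clopenin_subset[OF S(1)[OF that]] .
  obtain R where R: "R \<subseteq> V" "\<forall>v\<in>V. \<exists>n. (\<sigma> ^^ n) v \<in> R"
      "\<forall>r\<in>R. \<exists>p>0. (\<sigma> ^^ p) r = r \<and> (\<forall>i. 0 < i \<and> i < p \<longrightarrow> (\<sigma> ^^ i) r \<notin> R)"
    using finite_return_set[OF V] by blast
  obtain p where p: "\<forall>r\<in>R. 0 < p r \<and> (\<sigma> ^^ p r) r = r \<and> (\<forall>i. 0 < i \<and> i < p r \<longrightarrow> (\<sigma> ^^ i) r \<notin> R)"
    using bchoice[OF R(3)] by blast
  have \<sigma>V: "(\<sigma> ^^ i) v \<in> V" if "v \<in> V" for i v
    using funpow_image_subset[OF V(2), of i] that by blast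
  have gi: "(g ^^ i) ` S v \<subseteq> S ((\<sigma> ^^ i) v)" if "v \<in> V" for i v
  proof (induction i)
    case (Suc i)
    have "g ` S ((\<sigma> ^^ i) v) \<subseteq> S (\<sigma> ((\<sigma> ^^ i) v))" using gS[OF \<sigma>V[OF that]] by blast
    moreover have "(g ^^ Suc i) ` S v = g ` ((g ^^ i) ` S v)" by auto
    moreover have "g ` ((g ^^ i) ` S v) \<subseteq> g ` S ((\<sigma> ^^ i) v)" using Suc by (rule image_mono)
    ultimately show ?case by simp
  qed simp
  define contr where "contr r \<theta> u \<longleftrightarrow> \<theta> ((g ^^ p r) u) = u \<and>
     (\<forall>K. closed K \<and> K \<subseteq> S r \<and> K \<noteq> {} \<and> (\<theta> \<circ> g ^^ p r) ` K \<subseteq> K \<longrightarrow> u \<in> K)" for r \<theta> u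
  have "\<forall>r\<in>R. \<exists>\<theta>. \<theta> \<in> homeos (S r) \<and> (\<exists>u\<in>S r. contr r \<theta> u)"
  proof
    fix r assume r: "r \<in> R"
    have rV: "r \<in> V" using r R(1) by blast
    obtain q where q: "p r = Suc q" using p r by (metis gr0_implies_Suc)
    have ret: "(\<sigma> ^^ p r) r = r" using p r by blast
    have G: "g ^^ p r \<in> homeos X" using homeos_funpow[OF g] .
    have cont: "continuous_on (S r) (g ^^ p r)" "inj_on (g ^^ p r) (S r)"
      using homeos_continuous_on[OF G] homeos_inj_on[OF G] SX[OF rV]
      by (auto intro: continuous_on_subset inj_on_subset)
    have sub: "(g ^^ p r) ` S r \<subseteq> S r" using gi[OF rV, of "p r"] ret by simp
    have cl: "clopenin (S r) ((g ^^ p r) ` S r)"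
      using clopenin_relative[OF homeos_clopenin_image[OF cX G S(1)[OF rV]] sub SX[OF rV]] .
    \<comment> \<open>One strict inclusion suffices: a point \<open>y\<close> of
      \<open>S (\<sigma> r)\<close> missed by \<open>g\<close> is carried into \<open>S r\<close> by
      the remaining \<open>q\<close> steps and, by injectivity, is still missed there.\<close>
    have "(g ^^ p r) ` S r \<noteq> S r"
    proof
      assume eq: "(g ^^ p r) ` S r = S r"
      obtain y where y: "y \<in> S (\<sigma> r)" "y \<notin> g ` S r" using gS[OF rV] by blast
      have \<sigma>r: "\<sigma> r \<in> V" using V(2) rV by blast
      have "(\<sigma> ^^ q) (\<sigma> r) = r" using ret q by (simp add: funpow_swap1)
      then have "(g ^^ q) y \<in> S r" using gi[OF \<sigma>r, of q] y(1) by auto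
      then obtain x where x: "x \<in> S r" "(g ^^ q) y = (g ^^ p r) x" using eq by auto
      have "(g ^^ p r) x = (g ^^ q) (g x)" using q by (simp add: funpow_swap1)
      moreover have "g x \<in> X" "y \<in> X" using x y SX[OF rV] SX[OF \<sigma>r] homeos_mem[OF g] by auto
      ultimately have "y = g x"
        using x(2) inj_onD[OF homeos_inj_on[OF homeos_funpow[OF g]], of q y "g x"] by simp
      then show False using y x by blast
    qed
    from homeos_making_embedding_contract[OF cantor_space_clopenin[OF X S(1)[OF rV]] S(2)[OF rV] cont cl this]
    show "\<exists>\<theta>. \<theta> \<in> homeos (S r) \<and> (\<exists>u\<in>S r. contr r \<theta> u)"
      unfolding contr_def Bex_def .
  qed
  from bchoice[OF this] obtain \<eta> where \<eta>0: "\<forall>r\<in>R. \<eta> r \<in> homeos (S r) \<and> (\<exists>u\<in>S r. contr r (\<eta> r) u)"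
    by (elim exE)
  then have "\<forall>r\<in>R. \<exists>u. u \<in> S r \<and> contr r (\<eta> r) u" by blast
  from bchoice[OF this] obtain u where u: "\<forall>r\<in>R. u r \<in> S r \<and> contr r (\<eta> r) (u r)" by (elim exE)
  have \<eta>: "\<eta> r \<in> homeos (S r)" "u r \<in> S r" "\<eta> r ((g ^^ p r) (u r)) = u r"
     "closed K \<Longrightarrow> K \<subseteq> S r \<Longrightarrow> K \<noteq> {} \<Longrightarrow> (\<eta> r \<circ> g ^^ p r) ` K \<subseteq> K \<Longrightarrow> u r \<in> K" if "r \<in> R" for r K
    using bspec[OF \<eta>0 that] bspec[OF u that] unfolding contr_def by blast+
  \<comment> \<open>The index \<open>None\<close> stands for the complement of the corrected pieces,
    where the glued map is the identity.\<close>
  define I where "I = insert None (Some ` R)"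
  define A where "A i = (case i of None \<Rightarrow> X - (\<Union>r\<in>R. S r) | Some r \<Rightarrow> S r)" for i
  define \<Phi> where "\<Phi> i = (case i of None \<Rightarrow> (\<lambda>x. x) | Some r \<Rightarrow> \<eta> r)" for i
  have finR: "finite R" using R(1) V(1) finite_subset by blast
  have disj: "S v \<inter> S w = {}" if "v \<in> V" "w \<in> V" "v \<noteq> w" for v w
    using S(3) that by (simp add: disjoint_family_on_def)
  have Acl: "clopenin X (A i)" if "i \<in> I" for i
  proof (cases i)
    case None
    have "clopenin X (\<Union>r\<in>R. S r)" using R(1) S(1) by (intro clopenin_UN[OF finR]) blast
    then show ?thesis using None by (simp add: A_def clopenin_Diff)
  next
    case (Some r)
    then have "r \<in> V" using that R(1) by (auto simp: I_def)
    then show ?thesis using Some S(1) by (simp add: A_def)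
  qed
  have AU: "(\<Union>i\<in>I. A i) = X" using SX R(1) by (auto simp: I_def A_def)
  have Adisj: "disjoint_family_on A I"
    using disj R(1) by (fastforce simp: disjoint_family_on_def I_def A_def)
  have "\<forall>i\<in>I. \<exists>\<psi>. homeomorphism (A i) (A i) (\<Phi> i) \<psi>"
  proof
    fix i assume i: "i \<in> I"
    show "\<exists>\<psi>. homeomorphism (A i) (A i) (\<Phi> i) \<psi>"
    proof (cases i)
      case None
      then show ?thesis using homeomorphism_ident by (auto simp: \<Phi>_def)
    next
      case (Some r)
      then have "r \<in> R" using i by (auto simp: I_def)
      then show ?thesis using \<eta>(1) Some by (auto simp: homeos_def A_def \<Phi>_def)
    qed
  qed
  from bchoice[OF this] obtain \<Psi> where \<Psi>: "\<forall>i\<in>I. homeomorphism (A i) (A i) (\<Phi> i) (\<Psi> i)" by (elim exE)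
  have "\<exists>\<theta>\<in>homeos X. \<forall>i\<in>I. \<forall>x\<in>A i. \<theta> x = \<Phi> i x"
  proof (rule homeos_glue[OF cX _ _ AU Adisj AU Adisj])
    show "finite I" using finR by (simp add: I_def)
    show "compact (A i)" if "i \<in> I" for i using clopenin_compact[OF cX Acl[OF that]] .
    show "homeomorphism (A i) (A i) (\<Phi> i) (\<Psi> i)" if "i \<in> I" for i using \<Psi> that by blast
  qed
  then obtain \<theta> where \<theta>: "\<theta> \<in> homeos X" "\<forall>i\<in>I. \<forall>x\<in>A i. \<theta> x = \<Phi> i x" by blast
  have \<theta>S: "\<theta> x = \<eta> r x" if "r \<in> R" "x \<in> S r" for r x
  proof -
    have "Some r \<in> I" "x \<in> A (Some r)" using that by (simp_all add: I_def A_def)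
    then show ?thesis using \<theta>(2) by (simp add: \<Phi>_def)
  qed
  have \<theta>id: "\<theta> x = x" if "x \<in> X" "x \<notin> (\<Union>r\<in>R. S r)" for x
  proof -
    have "None \<in> I" "x \<in> A None" using that by (simp_all add: I_def A_def)
    then show ?thesis using \<theta>(2) by (simp add: \<Phi>_def)
  qed
  have \<theta>id': "\<theta> x = x" if "v \<in> V - R" "x \<in> S v" for v x
  proof (rule \<theta>id)
    show "x \<in> X" using that SX by blast
    show "x \<notin> (\<Union>r\<in>R. S r)" using disj that R(1) by blast
  qed
  have \<theta>img: "\<theta> ` S v = S v" if "v \<in> V" for v
  proof (cases "v \<in> R")
    case True
    then have "\<theta> ` S v = \<eta> v ` S v" using \<theta>S by (intro image_cong) auto
    then show ?thesis using homeos_image[OF \<eta>(1)[OF True]] by simp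
  next
    case False
    then have "\<theta> ` S v = (\<lambda>x. x) ` S v" using \<theta>id' that by (intro image_cong) auto
    then show ?thesis by simp
  qed
  define k where "k = \<theta> \<circ> g"
  have kS: "k x \<in> S (\<sigma> v)" if "v \<in> V" "x \<in> S v" for v x
  proof -
    have "g x \<in> S (\<sigma> v)" using gS[OF that(1)] that(2) by blast
    then show ?thesis using \<theta>img[of "\<sigma> v"] V(2) that(1) unfolding k_def by auto
  qed
  have kiS: "(k ^^ i) x \<in> S ((\<sigma> ^^ i) v)" if "v \<in> V" "x \<in> S v" for i v x
    by (induction i) (use that kS \<sigma>V in auto)
  \<comment> \<open>Before the return time the orbit visits only pieces outside \<open>R\<close>, on
    which \<open>\<theta>\<close> is the identity.\<close>
  have kg: "(k ^^ i) x = (g ^^ i) x" if "r \<in> R" "x \<in> S r" "i < p r" for r x i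
    using that(3)
  proof (induction i)
    case (Suc i)
    have rV: "r \<in> V" using R(1) that(1) by blast
    have "(\<sigma> ^^ Suc i) r \<in> V - R" using p that(1) Suc.prems \<sigma>V[OF rV] by blast
    moreover have "(g ^^ Suc i) x \<in> S ((\<sigma> ^^ Suc i) r)" using gi[OF rV, of "Suc i"] that(2) by blast
    ultimately have "\<theta> ((g ^^ Suc i) x) = (g ^^ Suc i) x" by (rule \<theta>id')
    then show ?case using Suc by (simp add: k_def)
  qed simp
  have kp: "(k ^^ p r) x = \<eta> r ((g ^^ p r) x)" if "r \<in> R" "x \<in> S r" for r x
  proof -
    have rV: "r \<in> V" using R(1) that(1) by blast
    have "0 < p r" using p that(1) by blast
    then obtain q where q: "p r = Suc q" using gr0_implies_Suc by blast
    have "(k ^^ p r) x = k ((k ^^ q) x)" using q by simp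
    also have "\<dots> = \<theta> (g ((k ^^ q) x))" by (simp add: k_def)
    also have "(k ^^ q) x = (g ^^ q) x" using kg[OF that, of q] q by simp
    also have "g ((g ^^ q) x) = (g ^^ p r) x" using q by simp
    also have "\<theta> ((g ^^ p r) x) = \<eta> r ((g ^^ p r) x)"
    proof (rule \<theta>S[OF that(1)])
      have "(g ^^ p r) x \<in> S ((\<sigma> ^^ p r) r)" using gi[OF rV, of "p r"] that(2) by blast
      then show "(g ^^ p r) x \<in> S r" using p that(1) by simp
    qed
    finally show ?thesis .
  qed
  \<comment> \<open>The periodic orbits of the points \<open>u r\<close>, one for each
    cycle.\<close>
  define F where "F = (\<Union>r\<in>R. (\<lambda>i. (k ^^ i) (u r)) ` {..<p r})"
  have "captures (\<Union>v\<in>V. S v) k F"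
    unfolding captures_def
  proof (intro conjI allI impI)
    show "finite F" using finR by (simp add: F_def)
    show "F \<subseteq> (\<Union>v\<in>V. S v)"
    proof
      fix x assume "x \<in> F"
      then obtain r i where ri: "r \<in> R" "x = (k ^^ i) (u r)" by (auto simp: F_def)
      then have "r \<in> V" using R(1) by blast
      then show "x \<in> (\<Union>v\<in>V. S v)" using kiS[of r "u r" i] \<eta>(2) ri \<sigma>V[of r i] by blast
    qed
    show "k ` F \<subseteq> F"
    proof (rule image_subsetI)
      fix x assume "x \<in> F"
      then obtain r i where ri: "r \<in> R" "i < p r" "x = (k ^^ i) (u r)" by (auto simp: F_def)
      show "k x \<in> F"
      proof (cases "Suc i = p r")
        case True
        then have "k x = (k ^^ p r) (u r)" using ri(3) by (simp flip: True)
        then have "k x = (k ^^ 0) (u r)" using kp[OF ri(1) \<eta>(2)] \<eta>(3) ri(1) by simp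
        then show ?thesis using p ri(1) unfolding F_def by blast
      next
        case False
        then have "Suc i < p r" "k x = (k ^^ Suc i) (u r)" using ri by simp_all
        then show ?thesis using ri(1) unfolding F_def by blast
      qed
    qed
    fix K assume K: "closed K \<and> K \<subseteq> (\<Union>v\<in>V. S v) \<and> K \<noteq> {} \<and> k ` K \<subseteq> K"
    then have ki: "(k ^^ n) ` K \<subseteq> K" for n using funpow_image_subset by blast
    obtain x v where x: "x \<in> K" "v \<in> V" "x \<in> S v" using K by blast
    obtain n where n: "(\<sigma> ^^ n) v \<in> R" using R(2) x(2) by blast
    define r where "r = (\<sigma> ^^ n) v"
    have r: "r \<in> R" using n r_def by simp
    have "(k ^^ n) x \<in> K \<inter> S r" using ki[of n] x kiS[OF x(2,3), of n] r_def by blast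
    moreover have "closed (K \<inter> S r)"
      using K compact_imp_closed[OF clopenin_compact[OF cX S(1)]] R(1) r by (intro closed_Int) auto
    moreover have "(\<eta> r \<circ> g ^^ p r) ` (K \<inter> S r) \<subseteq> K \<inter> S r"
    proof (rule image_subsetI)
      fix y assume y: "y \<in> K \<inter> S r"
      then have eq: "(\<eta> r \<circ> g ^^ p r) y = (k ^^ p r) y" using kp[OF r] by simp
      have "(k ^^ p r) y \<in> S ((\<sigma> ^^ p r) r)" using kiS[of r y "p r"] y R(1) r by blast
      then have "(k ^^ p r) y \<in> S r" using p r by simp
      moreover have "(k ^^ p r) y \<in> K" using ki y by blast
      ultimately show "(\<eta> r \<circ> g ^^ p r) y \<in> K \<inter> S r" using eq by simp
    qed
    ultimately have "u r \<in> K" using \<eta>(4)[OF r, of "K \<inter> S r"] by blast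
    moreover have "(k ^^ 0) (u r) \<in> F" using r p unfolding F_def by blast
    ultimately show "K \<inter> F \<noteq> {}" by auto
  qed
  moreover have "\<theta> x = x" if "x \<in> X - (\<Union>v\<in>V. S v)" for x
    using that R(1) by (intro \<theta>id) auto
  ultimately show ?thesis using \<theta>(1) \<theta>img unfolding k_def by blast
qed

lemma homeos_inverse_apply:
  assumes "f \<in> homeos X" "x \<in> X"
  shows "inv_into X f (f x) = x" "f (inv_into X f x) = x"
proof -
  show "inv_into X f (f x) = x" using homeos_inj_on[OF assms(1)] assms(2) by simp
  have "x \<in> f ` X" using homeos_image[OF assms(1)] assms(2) by simp
  then show "f (inv_into X f x) = x" by (rule f_inv_into_f)
qed

text \<open>Outside \<open>TT\<close> the map enters the forward invariant set \<open>SS\<close>, so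
  a closed invariant set either meets \<open>SS\<close> or lies in \<open>TT\<close>. On
  \<open>TT\<close> it is the inverse map that sends pieces into pieces, hence the cycle lemma is
  applied twice, to the map on \<open>SS\<close> and to its inverse on \<open>TT\<close>.\<close>

theorem captured_homeo_with_same_cells:
  fixes X :: "'a::metric_space set"
  assumes X: "cantor_space X" and f: "f \<in> homeos X" and P: "clopen_partition X \<P>"
  shows "\<exists>g\<in>homeos X. (\<forall>x\<in>X. cell \<P> (g x) = cell \<P> (f x)) \<and> (\<exists>F. captures X g F)"
proof -
  have cX: "compact X" using X cantor_space_compact by blast
  define f' where "f' = inv_into X f"
  have f': "f' \<in> homeos X" unfolding f'_def using homeos_inv_into[OF cX f] .
  have ff: "f' (f x) = x" "f (f' x) = x" if "x \<in> X" for x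
    unfolding f'_def using homeos_inverse_apply[OF f that] by auto
  have finP: "finite \<P>" and PU: "\<Union>\<P> = X" and Pcl: "\<And>C. C \<in> \<P> \<Longrightarrow> clopenin X C" "\<And>C. C \<in> \<P> \<Longrightarrow> C \<noteq> {}"
    using P by (auto simp: clopen_partition_def)
  have PX: "C \<subseteq> X" if "C \<in> \<P>" for C using PU that by blast
  have Pdisj: "x \<notin> D" if "C \<in> \<P>" "D \<in> \<P>" "C \<noteq> D" "x \<in> C" for C D x
    using cell_eq[OF P that(1,4)] cell_eq[OF P that(2), of x] that(3) by metis
  have Pinf: "infinite C" if "C \<in> \<P>" for C
    using cantor_space_openin_infinite[OF X] Pcl[OF that] by (simp add: clopenin_def)
  have avoid: "\<exists>x. x \<in> C - E" if "C \<in> \<P>" "finite E" for C E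
    using Diff_infinite_finite[OF that(2) Pinf[OF that(1)]] by (metis ex_in_conv finite.emptyI)
  \<comment> \<open>\<open>s C\<close> and \<open>n C\<close> become the centres of the attracting and the repelling set in \<open>C\<close>; \<open>w C\<close> only
    witnesses that the inclusions required by \<open>homeos_captures_cycles\<close> are strict.\<close>
  have "\<forall>C\<in>\<P>. \<exists>x. x \<in> C" using Pcl(2) by blast
  from bchoice[OF this] obtain s where s: "\<forall>C\<in>\<P>. s C \<in> C" by (elim exE)
  have "\<forall>C\<in>\<P>. \<exists>x. x \<in> C - (s ` \<P> \<union> f ` s ` \<P>)" by (intro ballI avoid finite_UnI finite_imageI finP)
  from bchoice[OF this] obtain n where n: "\<forall>C\<in>\<P>. n C \<in> C - (s ` \<P> \<union> f ` s ` \<P>)" by (elim exE)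
  \<comment> \<open>Avoiding \<open>f' (n C)\<close> as well ensures that no \<open>f (w B)\<close>
    equals some \<open>n C\<close>, so the sets \<open>N C\<close> can later be shrunk away from
    these images.\<close>
  have "\<forall>C\<in>\<P>. \<exists>x. x \<in> C - (s ` \<P> \<union> f ` s ` \<P> \<union> n ` \<P> \<union> f' ` n ` \<P>)" by (intro ballI avoid finite_UnI finite_imageI finP)
  from bchoice[OF this] obtain w where w: "\<forall>C\<in>\<P>. w C \<in> C - (s ` \<P> \<union> f ` s ` \<P> \<union> n ` \<P> \<union> f' ` n ` \<P>)" by (elim exE)
  have inX: "s C \<in> X" "n C \<in> X" "w C \<in> X" if "C \<in> \<P>" for C
    using bspec[OF s that] bspec[OF n that] bspec[OF w that] PX[OF that] by auto
  have mem: "s C \<in> C" "n C \<in> C" "w C \<in> C" if "C \<in> \<P>" for C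
    using bspec[OF s that] bspec[OF n that] bspec[OF w that] by auto
  have ne: "s D \<noteq> n C" "f (s D) \<noteq> n C" "s D \<noteq> w C" "f (s D) \<noteq> w C" "n D \<noteq> w C" "f' (n D) \<noteq> w C"
    if "C \<in> \<P>" "D \<in> \<P>" for C D
  proof -
    have "n C \<notin> s ` \<P>" "n C \<notin> f ` s ` \<P>" "w C \<notin> s ` \<P>" "w C \<notin> f ` s ` \<P>" "w C \<notin> n ` \<P>"
      "w C \<notin> f' ` n ` \<P>"
      using bspec[OF n that(1)] bspec[OF w that(1)] by simp_all
    then show "s D \<noteq> n C" "f (s D) \<noteq> n C" "s D \<noteq> w C" "f (s D) \<noteq> w C" "n D \<noteq> w C" "f' (n D) \<noteq> w C"
      using that(2) by (metis imageI)+
  qed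
  define oc where "oc C = cell \<P> (f (s C))" for C
  define ic where "ic C = cell \<P> (f' (n C))" for C
  have oc: "oc C \<in> \<P>" "f (s C) \<in> oc C" if "C \<in> \<P>" for C
    using cell_mem[OF P homeos_mem[OF f inX(1)[OF that]]] by (simp_all add: oc_def)
  have ic: "ic C \<in> \<P>" "f' (n C) \<in> ic C" if "C \<in> \<P>" for C
    using cell_mem[OF P homeos_mem[OF f' inX(2)[OF that]]] by (simp_all add: ic_def)
  \<comment> \<open>Both \<open>S C\<close> and its image are kept off \<open>E\<close>: the
    witnesses \<open>w\<close> then lie outside the attracting sets and outside their
    images.\<close>
  define E where "E = n ` \<P> \<union> w ` \<P>"
  have E: "closed E" using finP by (auto simp: E_def intro: finite_imp_closed)
  have "\<forall>C\<in>\<P>. \<exists>U. clopenin X U \<and> s C \<in> U \<and> U \<subseteq> C \<and> (\<forall>x\<in>U. f x \<in> oc C \<and> x \<notin> E \<and> f x \<notin> E)"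
  proof
    fix C assume C: "C \<in> \<P>"
    let ?O = "C \<inter> {x\<in>X. f x \<in> oc C} \<inter> (X \<inter> - E) \<inter> (X \<inter> f -` (- E))"
    have "openin (top_of_set X) C" using Pcl(1)[OF C] by (simp add: clopenin_def)
    moreover have "openin (top_of_set X) {x\<in>X. f x \<in> oc C}"
      using clopenin_vimage[OF homeos_continuous_on[OF f], of X] homeos_image[OF f] Pcl(1)[OF oc(1)[OF C]]
      by (simp add: clopenin_def)
    moreover have "openin (top_of_set X) (X \<inter> - E)" using E by (simp add: openin_open_Int open_Compl)
    moreover have "openin (top_of_set X) (X \<inter> f -` (- E))"
      using E homeos_continuous_on[OF f] by (intro continuous_openin_preimage_gen) (simp_all add: open_Compl)
    ultimately have op: "openin (top_of_set X) ?O" by (blast intro: openin_Int)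
    have "s C \<in> ?O"
    proof -
      have "s C \<notin> E" "f (s C) \<notin> E"
        unfolding E_def using ne[OF _ C] by auto
      then show ?thesis using mem(1)[OF C] oc(2)[OF C] inX(1)[OF C] by simp
    qed
    then obtain U where "clopenin X U" "s C \<in> U" "U \<subseteq> ?O"
      by (rule clopenin_neighbourhood[OF X op])
    then show "\<exists>U. clopenin X U \<and> s C \<in> U \<and> U \<subseteq> C \<and> (\<forall>x\<in>U. f x \<in> oc C \<and> x \<notin> E \<and> f x \<notin> E)"
      by (intro exI[of _ U]) auto
  qed
  from bchoice[OF this] obtain S where S: "\<forall>C\<in>\<P>. clopenin X (S C) \<and> s C \<in> S C \<and> S C \<subseteq> C \<and>
      (\<forall>x\<in>S C. f x \<in> oc C \<and> x \<notin> E \<and> f x \<notin> E)" by (elim exE)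
  define SS where "SS = (\<Union>C\<in>\<P>. S C)"
  have SScl: "clopenin X SS" unfolding SS_def using S by (intro clopenin_UN[OF finP]) blast
  have SSX: "SS \<subseteq> X" using clopenin_subset[OF SScl] .
  have SSE: "x \<notin> E" "f x \<notin> E" if "x \<in> SS" for x using S that by (auto simp: SS_def)
  \<comment> \<open>Keeping \<open>N\<close> off the image of \<open>SS\<close> sends the images of
    attracting sets into the part that \<open>\<psi>\<close> maps back to attracting sets; it also
    makes \<open>TT\<close> and \<open>SS\<close> disjoint. Excluding \<open>w\<close> and its
    images preserves the witnesses of strictness.\<close>
  define D where "D = SS \<union> f ` SS \<union> w ` \<P> \<union> f ` w ` \<P>"
  have "compact (f ` SS)"
    using clopenin_compact[OF cX SScl] continuous_on_subset[OF homeos_continuous_on[OF f] SSX]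
    by (intro compact_continuous_image)
  then have D: "closed D" unfolding D_def using clopenin_compact[OF cX SScl] finP
    by (intro closed_Un compact_imp_closed finite_imp_closed) auto
  have nD: "n C \<notin> D" if C: "C \<in> \<P>" for C
  proof -
    have nE: "n C \<in> E" using C by (simp add: E_def)
    then have "n C \<notin> SS" using SSE(1) by blast
    moreover have "n C \<notin> f ` SS"
    proof
      assume "n C \<in> f ` SS"
      then obtain x where "x \<in> SS" "n C = f x" by (rule imageE)
      then show False using SSE(2)[of x] nE by simp
    qed
    moreover have "n C \<notin> w ` \<P>" using ne(5)[OF _ C] by auto
    moreover have "n C \<notin> f ` w ` \<P>"
    proof
      assume "n C \<in> f ` w ` \<P>"
      then obtain B where B: "B \<in> \<P>" "n C = f (w B)" by auto
      then have "f' (n C) = w B" using ff(1)[OF inX(3)[OF B(1)]] by simp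
      then show False using ne(6)[OF B(1) C] by simp
    qed
    ultimately show ?thesis by (simp add: D_def)
  qed
  have "\<forall>C\<in>\<P>. \<exists>U. clopenin X U \<and> n C \<in> U \<and> U \<subseteq> C \<and> (\<forall>y\<in>U. f' y \<in> ic C \<and> y \<notin> D)"
  proof
    fix C assume C: "C \<in> \<P>"
    let ?O = "C \<inter> {x\<in>X. f' x \<in> ic C} \<inter> (X \<inter> - D)"
    have "openin (top_of_set X) C" using Pcl(1)[OF C] by (simp add: clopenin_def)
    moreover have "openin (top_of_set X) {x\<in>X. f' x \<in> ic C}"
      using clopenin_vimage[OF homeos_continuous_on[OF f'], of X] homeos_image[OF f'] Pcl(1)[OF ic(1)[OF C]]
      by (simp add: clopenin_def)
    moreover have "openin (top_of_set X) (X \<inter> - D)" using D by (simp add: openin_open_Int open_Compl)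
    ultimately have op: "openin (top_of_set X) ?O" by (blast intro: openin_Int)
    have "n C \<in> ?O"
      using mem(2)[OF C] ic(2)[OF C] inX(2)[OF C] nD[OF C] by simp
    then obtain U where "clopenin X U" "n C \<in> U" "U \<subseteq> ?O"
      by (rule clopenin_neighbourhood[OF X op])
    then show "\<exists>U. clopenin X U \<and> n C \<in> U \<and> U \<subseteq> C \<and> (\<forall>y\<in>U. f' y \<in> ic C \<and> y \<notin> D)"
      by (intro exI[of _ U]) auto
  qed
  from bchoice[OF this] obtain N where N: "\<forall>C\<in>\<P>. clopenin X (N C) \<and> n C \<in> N C \<and> N C \<subseteq> C \<and>
      (\<forall>y\<in>N C. f' y \<in> ic C \<and> y \<notin> D)" by (elim exE)
  have SC: "clopenin X (S C)" "s C \<in> S C" "S C \<subseteq> C" "w C \<in> C - S C" if C: "C \<in> \<P>" for C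
  proof -
    show "clopenin X (S C)" "s C \<in> S C" "S C \<subseteq> C" using bspec[OF S C] by simp_all
    have "w C \<in> E" using C by (simp add: E_def)
    then show "w C \<in> C - S C" using bspec[OF S C] mem(3)[OF C] by blast
  qed
  have NC: "clopenin X (N C)" "n C \<in> N C" "N C \<subseteq> C" "w C \<in> C - N C" if C: "C \<in> \<P>" for C
  proof -
    show "clopenin X (N C)" "n C \<in> N C" "N C \<subseteq> C" using bspec[OF N C] by simp_all
    have "w C \<in> D" using C by (simp add: D_def)
    then show "w C \<in> C - N C" using bspec[OF N C] mem(3)[OF C] by blast
  qed
  \<comment> \<open>Each cell is cut in two ways: index \<open>True\<close> pairs the complement of
    \<open>N\<close> with \<open>S\<close>, index \<open>False\<close> pairs \<open>N\<close> with
    the complement of \<open>S\<close>.\<close>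
  define I where "I = \<P> \<times> (UNIV :: bool set)"
  define A where "A i = (if snd i then fst i - N (fst i) else N (fst i))" for i
  define B where "B i = (if snd i then S (fst i) else fst i - S (fst i))" for i
  have Asub: "A i \<subseteq> fst i" "B i \<subseteq> fst i" if "i \<in> I" for i
  proof -
    have "fst i \<in> \<P>" using that by (auto simp: I_def)
    then show "A i \<subseteq> fst i" "B i \<subseteq> fst i"
      using NC(3)[of "fst i"] SC(3)[of "fst i"] by (auto simp: A_def B_def)
  qed
  have "\<exists>h\<in>homeos X. \<forall>i\<in>I. h ` A i = B i"
  proof (rule homeos_rearrange_clopen_pieces[OF X])
    show "finite I" using finP by (simp add: I_def)
    fix i assume "i \<in> I"
    then have C: "fst i \<in> \<P>" by (auto simp: I_def)
    show "clopenin X (A i) \<and> A i \<noteq> {}"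
      using NC[OF C] Pcl[OF C] by (auto simp: A_def intro: clopenin_Diff)
    show "clopenin X (B i) \<and> B i \<noteq> {}"
      using SC[OF C] Pcl[OF C] by (auto simp: B_def intro: clopenin_Diff)
  next
    have "x \<in> (\<Union>i\<in>I. A i) \<and> x \<in> (\<Union>i\<in>I. B i)" if x: "x \<in> X" for x
    proof -
      obtain C where C: "C \<in> \<P>" "x \<in> C" using cell_mem[OF P x] by blast
      then have "(C, x \<notin> N C) \<in> I" "x \<in> A (C, x \<notin> N C)" "(C, x \<in> S C) \<in> I" "x \<in> B (C, x \<in> S C)"
        by (simp_all add: I_def A_def B_def)
      then show ?thesis by blast
    qed
    then have "X \<subseteq> (\<Union>i\<in>I. A i)" "X \<subseteq> (\<Union>i\<in>I. B i)" by blast+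
    moreover have "A i \<subseteq> X" "B i \<subseteq> X" if "i \<in> I" for i
    proof -
      have "fst i \<in> \<P>" using that by (auto simp: I_def)
      then show "A i \<subseteq> X" "B i \<subseteq> X" using Asub[OF that] PX[of "fst i"] by auto
    qed
    ultimately show "(\<Union>i\<in>I. A i) = X" "(\<Union>i\<in>I. B i) = X" by blast+
  next
    have "A i \<inter> A j = {} \<and> B i \<inter> B j = {}" if "i \<in> I" "j \<in> I" "i \<noteq> j" for i j
    proof (cases "fst i = fst j")
      case True
      then have "snd i \<noteq> snd j" using that(3) by (simp add: prod_eq_iff)
      then show ?thesis using True by (auto simp: A_def B_def)
    next
      case False
      moreover have "fst i \<in> \<P>" "fst j \<in> \<P>" using that(1,2) by (auto simp: I_def)
      ultimately have "fst i \<inter> fst j = {}" using Pdisj[of "fst i" "fst j"] by blast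
      then show ?thesis using Asub[OF that(1)] Asub[OF that(2)] by blast
    qed
    then show "disjoint_family_on A I" "disjoint_family_on B I" by (auto simp: disjoint_family_on_def)
  qed
  then obtain \<psi> where \<psi>: "\<psi> \<in> homeos X" "\<forall>i\<in>I. \<psi> ` A i = B i" by blast
  have \<psi>S: "\<psi> ` (C - N C) = S C" and \<psi>N: "\<psi> ` N C = C - S C" if "C \<in> \<P>" for C
    using bspec[OF \<psi>(2), of "(C, True)"] bspec[OF \<psi>(2), of "(C, False)"] that by (simp_all add: I_def A_def B_def)
  have \<psi>C: "\<psi> x \<in> C" if "C \<in> \<P>" "x \<in> C" for C x
    using \<psi>S[OF that(1)] \<psi>N[OF that(1)] that(2) SC(3)[OF that(1)] by blast
  define g0 where "g0 = \<psi> \<circ> f"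
  have g0: "g0 \<in> homeos X" unfolding g0_def using homeos_comp[OF f \<psi>(1)] .
  have g0cell: "cell \<P> (g0 x) = cell \<P> (f x)" if "x \<in> X" for x
  proof -
    have C: "cell \<P> (f x) \<in> \<P>" "f x \<in> cell \<P> (f x)" using cell_mem[OF P homeos_mem[OF f that]] by auto
    show ?thesis using cell_eq[OF P C(1) \<psi>C[OF C]] by (simp add: g0_def)
  qed
  define T where "T C = {x\<in>X. f x \<in> N C}" for C
  have T: "clopenin X (T C)" "f' (n C) \<in> T C" if "C \<in> \<P>" for C
    using clopenin_vimage[OF homeos_continuous_on[OF f], of X] homeos_image[OF f] NC[OF that]
      ff(2) homeos_mem[OF f'] inX(2)[OF that] by (simp_all add: T_def)
  have TS: "x \<notin> SS" if "C \<in> \<P>" "x \<in> T C" for x C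
  proof
    assume "x \<in> SS"
    then have "f x \<in> D" by (simp add: D_def)
    then show False using bspec[OF N that(1)] that(2) by (simp add: T_def)
  qed
  have Tic: "x \<in> ic C" if "C \<in> \<P>" "x \<in> T C" for x C
  proof -
    have "x \<in> X" "f x \<in> N C" using that(2) by (simp_all add: T_def)
    then show ?thesis using bspec[OF N that(1)] ff(1)[of x] by auto
  qed
  have disjS: "disjoint_family_on S \<P>"
    unfolding disjoint_family_on_def using Pdisj SC(3) by blast
  have disjT: "disjoint_family_on T \<P>"
    unfolding disjoint_family_on_def T_def using Pdisj NC(3) by blast
  have "\<exists>\<theta>\<in>homeos X. (\<forall>x\<in>X - SS. \<theta> x = x) \<and> (\<forall>C\<in>\<P>. \<theta> ` S C = S C) \<and> (\<exists>F. captures SS (\<theta> \<circ> g0) F)"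
    unfolding SS_def
  proof (rule homeos_captures_cycles[OF X g0 finP _ SC(1) _ disjS, where \<sigma> = oc])
    show "oc ` \<P> \<subseteq> \<P>" using oc(1) by blast
    show "S C \<noteq> {}" if "C \<in> \<P>" for C using SC(2)[OF that] by blast
    fix C assume C: "C \<in> \<P>"
    have ocC: "oc C \<in> \<P>" using oc(1)[OF C] .
    have fS: "f ` S C \<subseteq> oc C - N (oc C)"
    proof (rule image_subsetI)
      fix x assume x: "x \<in> S C"
      then have "f x \<in> D" using C by (auto simp: D_def SS_def)
      then show "f x \<in> oc C - N (oc C)" using x bspec[OF S C] bspec[OF N ocC] by blast
    qed
    have wf: "w (oc C) \<notin> f ` S C"
    proof
      assume "w (oc C) \<in> f ` S C"
      then obtain x where "x \<in> S C" "w (oc C) = f x" by (rule imageE)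
      moreover have "w (oc C) \<in> E" using ocC by (simp add: E_def)
      ultimately show False using bspec[OF S C] by simp
    qed
    have "g0 ` S C \<subseteq> S (oc C)"
      unfolding g0_def image_comp[symmetric] using image_mono[OF fS, of \<psi>] \<psi>S[OF ocC] by simp
    moreover have "\<psi> (w (oc C)) \<in> S (oc C)" using \<psi>S[OF ocC] NC(4)[OF ocC] by blast
    moreover have "\<psi> (w (oc C)) \<notin> g0 ` S C"
    proof
      assume "\<psi> (w (oc C)) \<in> g0 ` S C"
      then obtain x where x: "x \<in> S C" "\<psi> (w (oc C)) = \<psi> (f x)" by (auto simp: g0_def)
      have "x \<in> X" using x(1) SC(3)[OF C] PX[OF C] by blast
      then have "w (oc C) = f x"
        using inj_onD[OF homeos_inj_on[OF \<psi>(1)] x(2)] inX(3)[OF ocC] homeos_mem[OF f] by blast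
      then show False using wf x(1) by blast
    qed
    ultimately show "g0 ` S C \<subset> S (oc C)" by blast
  qed
  then obtain \<theta> F1 where \<theta>: "\<theta> \<in> homeos X" "\<forall>x\<in>X - SS. \<theta> x = x" "\<forall>C\<in>\<P>. \<theta> ` S C = S C"
    and F1: "captures SS (\<theta> \<circ> g0) F1" by blast
  have \<theta>SS: "\<theta> x \<in> SS" if "x \<in> SS" for x using \<theta>(3) that by (auto simp: SS_def)
  define g1 where "g1 = \<theta> \<circ> g0"
  have g1: "g1 \<in> homeos X" unfolding g1_def using homeos_comp[OF g0 \<theta>(1)] .
  have \<theta>cell: "cell \<P> (\<theta> x) = cell \<P> x" if "x \<in> X" for x
  proof (cases "x \<in> SS")
    case True
    then obtain C where C: "C \<in> \<P>" "x \<in> S C" by (auto simp: SS_def)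
    then have "\<theta> x \<in> S C" using \<theta>(3) by blast
    then have "\<theta> x \<in> C" "x \<in> C" using C(2) SC(3)[OF C(1)] by auto
    then show ?thesis using cell_eq[OF P C(1), of x] cell_eq[OF P C(1), of "\<theta> x"] by simp
  next
    case False
    then show ?thesis using \<theta>(2) that by simp
  qed
  have g1cell: "cell \<P> (g1 x) = cell \<P> (f x)" if "x \<in> X" for x
    using \<theta>cell[OF homeos_mem[OF g0 that]] g0cell[OF that] by (simp add: g1_def)
  define k where "k = inv_into X g1"
  have k: "k \<in> homeos X" unfolding k_def using homeos_inv_into[OF cX g1] .
  have kg: "k (g1 x) = x" "g1 (k x) = x" if "x \<in> X" for x
    unfolding k_def using homeos_inverse_apply[OF g1 that] by auto
  define TT where "TT = (\<Union>C\<in>\<P>. T C)"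
  \<comment> \<open>This is the backward counterpart of the inclusion for \<open>SS\<close>: every
    point outside \<open>SS\<close> has its preimage in the \<open>T\<close> of its own cell. As
    \<open>T C\<close> lies in \<open>ic C\<close> and misses \<open>SS\<close>, the inverse maps it
    into \<open>T (ic C)\<close>.\<close>
  have g1T: "\<exists>t\<in>T C. g1 t = x" if x: "C \<in> \<P>" "x \<in> C" "x \<notin> SS" for C x
  proof -
    have "x \<in> \<psi> ` N C" using x \<psi>N[OF x(1)] by (auto simp: SS_def)
    then obtain y where y: "y \<in> N C" "\<psi> y = x" by blast
    have "y \<in> X" using y(1) NC(3)[OF x(1)] PX[OF x(1)] by blast
    then have t: "f' y \<in> T C" "f (f' y) = y" using y(1) ff(2) homeos_mem[OF f'] by (auto simp: T_def)
    have "g1 (f' y) = \<theta> x" using t(2) y(2) by (simp add: g1_def g0_def)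
    also have "\<dots> = x" using bspec[OF \<theta>(2), of x] x PX[OF x(1)] by blast
    finally show ?thesis using t(1) by blast
  qed
  have "\<exists>\<theta>\<in>homeos X. (\<forall>x\<in>X - TT. \<theta> x = x) \<and> (\<forall>C\<in>\<P>. \<theta> ` T C = T C) \<and> (\<exists>F. captures TT (\<theta> \<circ> k) F)"
    unfolding TT_def
  proof (rule homeos_captures_cycles[OF X k finP _ T(1) _ disjT, where \<sigma> = ic])
    show "ic ` \<P> \<subseteq> \<P>" using ic(1) by blast
    show "T C \<noteq> {}" if "C \<in> \<P>" for C using T(2)[OF that] by blast
    fix C assume C: "C \<in> \<P>"
    have icC: "ic C \<in> \<P>" using ic(1)[OF C] .
    have TX: "T B \<subseteq> X" for B by (auto simp: T_def)
    have "k ` T C \<subseteq> T (ic C)"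
    proof (rule image_subsetI)
      fix x assume x: "x \<in> T C"
      obtain t where t: "t \<in> T (ic C)" "g1 t = x" using g1T[OF icC Tic[OF C x] TS[OF C x]] by blast
      then have "k x = t" using kg(1)[of t] TX by blast
      then show "k x \<in> T (ic C)" using t(1) by simp
    qed
    \<comment> \<open>The missed point is the preimage of \<open>w (ic C)\<close>, which lies in
      \<open>T (ic C)\<close>; but \<open>w (ic C)\<close> is not in \<open>T C\<close>, because its
      image under \<open>f\<close> avoids \<open>N C\<close>.\<close>
    moreover have "\<exists>t\<in>T (ic C). t \<notin> k ` T C"
    proof -
      have wE: "w (ic C) \<in> E" using icC by (simp add: E_def)
      obtain t where t: "t \<in> T (ic C)" "g1 t = w (ic C)"
        using g1T[OF icC, of "w (ic C)"] SC(4)[OF icC] SSE(1) wE by blast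
      have "t \<notin> k ` T C"
      proof
        assume "t \<in> k ` T C"
        then obtain x where x: "x \<in> T C" "t = k x" by blast
        then have "w (ic C) = x" using t(2) kg(2)[of x] TX by auto
        then have "f (w (ic C)) \<in> N C" using x(1) by (simp add: T_def)
        moreover have "f (w (ic C)) \<in> D" using icC by (simp add: D_def)
        ultimately show False using bspec[OF N C] by blast
      qed
      then show ?thesis using t(1) by blast
    qed
    ultimately show "k ` T C \<subset> T (ic C)" by blast
  qed
  then obtain \<eta> F2 where \<eta>: "\<eta> \<in> homeos X" "\<forall>x\<in>X - TT. \<eta> x = x" "\<forall>C\<in>\<P>. \<eta> ` T C = T C"
    and F2: "captures TT (\<eta> \<circ> k) F2" by blast
  have TTX: "TT \<subseteq> X" by (auto simp: TT_def T_def)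
  define \<eta>' where "\<eta>' = inv_into X \<eta>"
  have \<eta>': "\<eta>' \<in> homeos X" unfolding \<eta>'_def using homeos_inv_into[OF cX \<eta>(1)] .
  have \<eta>\<eta>: "\<eta>' (\<eta> x) = x" "\<eta> (\<eta>' x) = x" if "x \<in> X" for x
    unfolding \<eta>'_def using homeos_inverse_apply[OF \<eta>(1) that] by auto
  have \<eta>'id: "\<eta>' x = x" if "x \<in> X" "x \<notin> TT" for x
    using \<eta>\<eta>(1)[OF that(1)] \<eta>(2) that by simp
  have \<eta>'T: "\<eta>' x \<in> T C" if C: "C \<in> \<P>" "x \<in> T C" for x C
  proof -
    have "x \<in> \<eta> ` T C" using \<eta>(3) C by simp
    then obtain y where "y \<in> T C" "x = \<eta> y" by blast
    moreover have "y \<in> X" using \<open>y \<in> T C\<close> by (simp add: T_def)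
    ultimately show ?thesis using \<eta>\<eta>(1) by simp
  qed
  \<comment> \<open>Correcting the inverse \<open>k\<close> to \<open>\<eta> \<circ> k\<close>
    amounts to applying the inverse of \<open>\<eta>\<close> before \<open>g1\<close>.\<close>
  define g2 where "g2 = g1 \<circ> \<eta>'"
  have g2: "g2 \<in> homeos X" unfolding g2_def using homeos_comp[OF \<eta>' g1] .
  have inv1: "(\<eta> \<circ> k) (g2 x) = x" and inv2: "g2 ((\<eta> \<circ> k) x) = x" if "x \<in> X" for x
    using kg(1)[OF homeos_mem[OF \<eta>' that]] \<eta>\<eta>(2)[OF that] \<eta>\<eta>(1)[OF homeos_mem[OF k that]] kg(2)[OF that]
    by (simp_all add: g2_def)
  have g2_eq: "g2 x = g1 x" if "x \<in> X" "x \<notin> TT" for x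
    using \<eta>'id[OF that] by (simp add: g2_def)
  \<comment> \<open>Although \<open>T C\<close> may be spread out under the partition refined by
    images, \<open>\<eta>'\<close> keeps each \<open>T C\<close>, whose image under \<open>f\<close>
    lies in the single cell \<open>C\<close>.\<close>
  have g2cell: "cell \<P> (g2 x) = cell \<P> (f x)" if x: "x \<in> X" for x
  proof (cases "x \<in> TT")
    case True
    then obtain C where C: "C \<in> \<P>" "x \<in> T C" by (auto simp: TT_def)
    have "f (\<eta>' x) \<in> C" "f x \<in> C" using \<eta>'T[OF C] C NC(3)[OF C(1)] by (auto simp: T_def)
    then have "cell \<P> (f (\<eta>' x)) = cell \<P> (f x)"
      using cell_eq[OF P C(1), of "f x"] cell_eq[OF P C(1), of "f (\<eta>' x)"] by simp
    then show ?thesis using g1cell[OF homeos_mem[OF \<eta>' x]] by (simp add: g2_def)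
  next
    case False
    then show ?thesis using g2_eq[OF x] g1cell[OF x] by simp
  qed
  have F1': "finite F1" "F1 \<subseteq> SS" "g1 ` F1 \<subseteq> F1" using F1 by (auto simp: captures_def g1_def)
  have F2': "finite F2" "F2 \<subseteq> TT" "(\<eta> \<circ> k) ` F2 \<subseteq> F2" using F2 by (auto simp: captures_def)
  have STdisj: "x \<notin> TT" if "x \<in> SS" for x using TS that by (auto simp: TT_def)
  have g1SS: "g1 x \<in> SS" if x: "x \<in> X" "f x \<notin> (\<Union>C\<in>\<P>. N C)" for x
  proof -
    obtain C where C: "C \<in> \<P>" "f x \<in> C" using cell_mem[OF P homeos_mem[OF f x(1)]] by blast
    then have "f x \<in> C - N C" using x(2) by blast
    then have "g0 x \<in> S C" using imageI[of "f x" "C - N C" \<psi>] \<psi>S[OF C(1)] by (simp add: g0_def)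
    then have "g0 x \<in> SS" using C(1) by (auto simp: SS_def)
    then show ?thesis using \<theta>SS by (simp add: g1_def)
  qed
  have outT: "g1 x \<in> SS" if "x \<in> X" "x \<notin> TT" for x
    using that by (intro g1SS) (auto simp: TT_def T_def)
  have "captures X g2 (F1 \<union> F2)"
    unfolding captures_def
  proof (intro conjI allI impI)
    show "finite (F1 \<union> F2)" using F1' F2' by simp
    show "F1 \<union> F2 \<subseteq> X" using F1' F2' SSX TTX by blast
    have "g2 x \<in> F1" if "x \<in> F1" for x
    proof -
      have "x \<in> SS" using that F1'(2) by blast
      then have "g2 x = g1 x" using g2_eq SSX STdisj by blast
      then show ?thesis using F1'(3) that by auto
    qed
    moreover have "g2 x \<in> F2" if x: "x \<in> F2" for x
    proof -
      \<comment> \<open>\<open>F2\<close> is known to be invariant under the inverse map only; an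
        injective self-map of a finite set is onto, which gives invariance under
        \<open>g2\<close>.\<close>
      have "inj_on (\<eta> \<circ> k) F2"
        using homeos_inj_on[OF homeos_comp[OF k \<eta>(1)]] F2'(2) TTX by (meson inj_on_subset)
      then have "(\<eta> \<circ> k) ` F2 = F2" using F2' by (intro endo_inj_surj)
      then obtain z where z: "z \<in> F2" "x = (\<eta> \<circ> k) z" using x by blast
      then have "z \<in> X" using F2'(2) TTX by blast
      then show ?thesis using inv2[of z] z by simp
    qed
    ultimately show "g2 ` (F1 \<union> F2) \<subseteq> F1 \<union> F2" by blast
    fix K assume K: "closed K \<and> K \<subseteq> X \<and> K \<noteq> {} \<and> g2 ` K \<subseteq> K"
    show "K \<inter> (F1 \<union> F2) \<noteq> {}"
    proof (cases "K \<inter> SS = {}")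
      case False
      have "closed (K \<inter> SS)"
        using K clopenin_compact[OF cX SScl] by (intro closed_Int compact_imp_closed) auto
      moreover have "g1 ` (K \<inter> SS) \<subseteq> K \<inter> SS"
      proof (rule image_subsetI)
        fix x assume x: "x \<in> K \<inter> SS"
        then have "x \<in> X" "x \<notin> TT" using SSX STdisj by blast+
        then have "g1 x \<in> SS" "g1 x = g2 x" using outT g2_eq by simp_all
        then show "g1 x \<in> K \<inter> SS" using K x by auto
      qed
      ultimately have "(K \<inter> SS) \<inter> F1 \<noteq> {}"
        using F1 False unfolding captures_def g1_def[symmetric] by blast
      then show ?thesis by blast
    next
      case True
      have KTT: "K \<subseteq> TT"
      proof (rule subsetI, rule ccontr)
        fix x assume x: "x \<in> K" "x \<notin> TT"
        then have "x \<in> X" using K by blast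
        then have "g2 x \<in> SS" using outT g2_eq x(2) by simp
        moreover have "g2 x \<in> K" using K x(1) by blast
        ultimately show False using True by blast
      qed
      \<comment> \<open>The set repelling under \<open>g2\<close> is handled through the inverse map, so \<open>K\<close> is first
        shrunk to a subset that is also backward invariant.\<close>
      define M where "M = (\<Inter>n. (g2 ^^ n) ` K)"
      have cK: "compact K" using compact_Int_closed[OF cX, of K] K by (simp add: Int_absorb1)
      have cn: "compact ((g2 ^^ n) ` K)" for n
        using homeos_funpow_continuous_on[OF g2, of n] K cK
        by (intro compact_continuous_image) (auto intro: continuous_on_subset)
      have "M \<noteq> {}"
        unfolding M_def
      proof (rule compact_nested_Inter_nonempty)
        show "(g2 ^^ Suc n) ` K \<subseteq> (g2 ^^ n) ` K" for n
        proof -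
          have "(g2 ^^ Suc n) ` K = (g2 ^^ n) ` (g2 ` K)" by (simp add: image_comp funpow_swap1 o_def)
          then show ?thesis using K by (simp add: image_mono)
        qed
      qed (use cn K in auto)
      moreover have "closed M" unfolding M_def using cn compact_imp_closed by blast
      moreover have MK: "M \<subseteq> K" 
      proof -
        have "M \<subseteq> (g2 ^^ 0) ` K" unfolding M_def by (rule INT_lower) simp
        then show ?thesis by simp
      qed
      moreover have "(\<eta> \<circ> k) ` M \<subseteq> M"
      proof (rule image_subsetI)
        fix y assume y: "y \<in> M"
        have "(\<eta> \<circ> k) y \<in> (g2 ^^ n) ` K" for n
        proof -
          have "y \<in> (g2 ^^ Suc n) ` K" using y unfolding M_def by blast
          then obtain x where x: "x \<in> K" "y = g2 ((g2 ^^ n) x)" by auto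
          have "(g2 ^^ n) x \<in> X" using homeos_funpow_continuous_on[OF g2, of n] x(1) K by blast
          then have "(\<eta> \<circ> k) y = (g2 ^^ n) x" using inv1 x(2) by simp
          then show ?thesis using x(1) by blast
        qed
        then show "(\<eta> \<circ> k) y \<in> M" unfolding M_def by blast
      qed
      moreover have "M \<subseteq> TT" using MK KTT by blast
      ultimately have "M \<inter> F2 \<noteq> {}" using F2 unfolding captures_def by simp
      then show ?thesis using MK by blast
    qed
  qed
  then show ?thesis using g2 g2cell by blast
qed

section \<open>Finiteness of the non-wandering set\<close>

theorem strongly_topologically_stable_imp_finite_nonwandering:
  fixes X :: "'a::metric_space set"
  assumes X: "cantor_space X" and f: "f \<in> homeos X" and st: "strongly_topologically_stable X f"
  shows "finite (nonwandering X f)"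
proof (cases "X = {}")
  case True
  then show ?thesis by (simp add: nonwandering_def)
next
  case False
  have cX: "compact X" using X cantor_space_compact by blast
  \<comment> \<open>The bound 1 on the displacement of \<open>h\<close> is an arbitrary positive
    choice.\<close>
  obtain \<delta> where \<delta>: "\<delta> > 0" "\<forall>g\<in>homeos X. Dhom X f g < \<delta> \<longrightarrow>
      (\<exists>h. continuous_on X h \<and> h ` X = X \<and> dC0 X h id < 1 \<and> (\<forall>x\<in>X. h (g x) = f (h x)))"
    using st zero_less_one unfolding strongly_topologically_stable_def by blast
  obtain \<P> where P: "clopen_partition X \<P>"
    "\<forall>g\<in>homeos X. (\<forall>x\<in>X. cell \<P> (g x) = cell \<P> (f x)) \<longrightarrow> Dhom X f g < \<delta>"
    using Dhom_less_if_same_cells[OF X False f \<delta>(1)] by blast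
  obtain g F where g: "g \<in> homeos X" "\<forall>x\<in>X. cell \<P> (g x) = cell \<P> (f x)" and F: "captures X g F"
    using captured_homeo_with_same_cells[OF X f P(1)] by blast
  obtain h where h: "continuous_on X h" "h ` X = X" "\<forall>x\<in>X. h (g x) = f (h x)"
    using \<delta>(2) P(2) g by blast
  have "captures X f (h ` F)"
    using captures_factor[OF cX F _ h] homeos_image[OF g(1)] by simp
  then have "nonwandering X f \<subseteq> h ` F" "finite (h ` F)"
    using nonwandering_subset_if_captures[OF cX f strongly_topologically_stable_imp_shadowing[OF X f st]]
    by (auto simp: captures_def)
  then show ?thesis using finite_subset by blast
qed

theorem theorem1p3:
  fixes X :: "'a::metric_space set" and f :: "'a \<Rightarrow> 'a"
  assumes "cantor_space X"
    and "f \<in> homeos X"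
    and "strongly_topologically_stable X f"
  shows "shadowing X f \<and> finite (nonwandering X f)"
  using strongly_topologically_stable_imp_shadowing[OF assms]
    strongly_topologically_stable_imp_finite_nonwandering[OF assms] ..

end
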